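(* Let $k\ge2$, $\mathcal{A}_k=\{1,\dots,k\}$, let $X$ be a two-sided Arnoux-Rauzy subshift over $\mathcal{A}_k$ with index sequence $(i_n)_{n\ge1}$ and unique shift-invariant probability measure $\nu$, and let $f:\mathcal{A}_k\to\mathbb{R}$ be non-constant. If $(i_n)$ contains infinitely many $2$-runs, then $\sigma_{\mathrm{pp}}(H_x)=\emptyset$ for $\nu$-almost every $x\in X$.
   Context: $\mathbb{N}=\{1,2,\dots\}$. For $x\in\mathcal{A}_k^{\mathbb{N}}$ or $\mathcal{A}_k^{\mathbb{Z}}$, $F_x(n)$ is the set of factors (contiguous subwords) of $x$ of length $n$, and $F_x=\bigcup_n F_x(n)$. A factor $u$ is right-special if there are letters $a\ne b$ with $ua,ub\in F_x$; left-special if there are $a\neq b$ with $au,bu\in F_x$; bispecial if both. The empty word $\varepsilon$ is counted as a bispecial factor. The sequence $x$ is an Arnoux-Rauzy (AR) sequence if (1) $x$ is uniformly recurrent (each factor occurs with bounded gaps), (2) $|F_x(n)|=(k-1)n+1$ for all $n\in\mathbb{N}$, and (3) for each $n$, $F_x(n)$ contains exactly one right-special factor and exactly one left-special factor. The associated two-sided AR subshift is $X=\{y\in\mathcal{A}_k^{\mathbb{Z}} : F_y(n)=F_x(n)\ \forall n\in\mathbb{N}\}$. It is known (Arnoux-Rauzy) that $X$ is uniquely ergodic, i.e. carries a unique shift-invariant probability measure. Index sequence: let $\varepsilon=w_1,w_2,w_3,\dots$ be the bispecial factors ordered so that $0=|w_1|<|w_2|<\cdots$. Then $i_n\in\mathcal{A}_k$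 is the unique letter such that $i_nw_n$ is right-special. A $2$-run in $(i_n)$ is a pair $(a,l)\in\mathcal{A}_k\times\mathbb{N}$ with $i_l=i_{l+1}=a$. For $x\in X$, $H_x$ is the bounded self-adjoint operator on $\mathcal{H}=\ell^2(\mathbb{Z})$ given by $(H_x\phi)(n)=\phi(n+1)+\phi(n-1)+V_x(n)\phi(n)$ with $V_x(n)=f(x_n)$. For $\phi\in\mathcal{H}$, the spectral measure $\mu_\phi$ is defined by $\langle\phi,(H_x-z)^{-1}\phi\rangle=\int_{\mathbb{R}}\frac{d\mu_\phi(t)}{t-z}$ for all $z$ with $\mathrm{Im}\,z>0$; $\mathcal{H}_{\mathrm{pp}}=\{\phi\in\mathcal{H}:\mu_\phi\text{ is pure point}\}$ and $\sigma_{\mathrm{pp}}(H_x)=\sigma(H_x|_{\mathcal{H}_{\mathrm{pp}}})$. *)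

theory Defs
  imports "HOL-Probability.Probability"
begin

section \<open>Words and special factors\<close>

text \<open>
  Letters are natural numbers and words are lists. The index type \<open>'i\<close> is \<open>nat\<close> for one-sided and
  \<open>int\<close> for two-sided sequences. One-sided sequences are indexed from 0; all notions below are
  insensitive to this.
\<close>

definition alphabet :: "nat \<Rightarrow> nat set" where
  "alphabet k = {1..k}"

definition word_at :: "('i::semiring_1 \<Rightarrow> nat) \<Rightarrow> 'i \<Rightarrow> nat \<Rightarrow> nat list" where
  "word_at x m n = map (\<lambda>j. x (m + of_nat j)) [0..<n]"

definition factors :: "('i::semiring_1 \<Rightarrow> nat) \<Rightarrow> nat \<Rightarrow> nat list set" where
  "factors x n = range (\<lambda>m. word_at x m n)"

text \<open>The union includes \<open>n = 0\<close>, so the empty word is a factor. It is bispecial as soon as two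
  distinct letters occur, which is the convention for the empty word.\<close>

definition factor_set :: "('i::semiring_1 \<Rightarrow> nat) \<Rightarrow> nat list set" where
  "factor_set x = (\<Union>n. factors x n)"

definition right_special :: "nat list set \<Rightarrow> nat list \<Rightarrow> bool" where
  "right_special L u \<longleftrightarrow> u \<in> L \<and> (\<exists>a b. a \<noteq> b \<and> u @ [a] \<in> L \<and> u @ [b] \<in> L)"

definition left_special :: "nat list set \<Rightarrow> nat list \<Rightarrow> bool" where
  "left_special L u \<longleftrightarrow> u \<in> L \<and> (\<exists>a b. a \<noteq> b \<and> a # u \<in> L \<and> b # u \<in> L)"

definition bispecial :: "nat list set \<Rightarrow> nat list \<Rightarrow> bool" where
  "bispecial L u \<longleftrightarrow> right_special L u \<and> left_special L u"


section \<open>Arnoux-Rauzy sequences and subshifts\<close>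

definition uniformly_recurrent :: "('i::semiring_1 \<Rightarrow> nat) \<Rightarrow> bool" where
  "uniformly_recurrent x \<longleftrightarrow>
     (\<forall>u \<in> factor_set x. \<exists>R::nat. \<forall>m. \<exists>j\<le>R. word_at x (m + of_nat j) (length u) = u)"

definition AR_sequence :: "nat \<Rightarrow> ('i::semiring_1 \<Rightarrow> nat) \<Rightarrow> bool" where
  "AR_sequence k x \<longleftrightarrow>
     range x \<subseteq> alphabet k \<and>
     uniformly_recurrent x \<and>
     (\<forall>n\<ge>1. card (factors x n) = (k - 1) * n + 1) \<and>
     (\<forall>n\<ge>1. (\<exists>!u. u \<in> factors x n \<and> right_special (factor_set x) u) \<and>
             (\<exists>!u. u \<in> factors x n \<and> left_special (factor_set x) u))"

definition associated_subshift :: "nat \<Rightarrow> ('i::semiring_1 \<Rightarrow> nat) \<Rightarrow> (int \<Rightarrow> nat) set" where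
  "associated_subshift k x = {y. range y \<subseteq> alphabet k \<and> (\<forall>n\<ge>1. factors y n = factors x n)}"

definition AR_subshift :: "nat \<Rightarrow> (int \<Rightarrow> nat) set \<Rightarrow> bool" where
  "AR_subshift k X \<longleftrightarrow>
     (\<exists>x :: nat \<Rightarrow> nat. AR_sequence k x \<and> X = associated_subshift k x) \<or>
     (\<exists>x :: int \<Rightarrow> nat. AR_sequence k x \<and> X = associated_subshift k x)"

text \<open>For an Arnoux-Rauzy subshift all elements have the same factors as the generating sequence, so
  this is the factor set of that sequence.\<close>

definition subshift_language :: "(int \<Rightarrow> nat) set \<Rightarrow> nat list set" where
  "subshift_language X = (\<Union>y\<in>X. factor_set y)"


section \<open>Index sequence and 2-runs\<close>

text \<open>Enumerations and index sequences start at 1; values at 0 are irrelevant.\<close>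

definition bispecial_enumeration :: "nat list set \<Rightarrow> (nat \<Rightarrow> nat list) \<Rightarrow> bool" where
  "bispecial_enumeration L w \<longleftrightarrow>
     w ` {1..} = {u. bispecial L u} \<and> strict_mono_on {1..} (\<lambda>n. length (w n))"

definition index_sequence :: "nat \<Rightarrow> (int \<Rightarrow> nat) set \<Rightarrow> (nat \<Rightarrow> nat) \<Rightarrow> bool" where
  "index_sequence k X i \<longleftrightarrow>
     (\<exists>w. bispecial_enumeration (subshift_language X) w \<and>
        (\<forall>n\<ge>1. i n \<in> alphabet k \<and>
           (\<forall>a \<in> alphabet k. right_special (subshift_language X) (a # w n) \<longleftrightarrow> a = i n)))"

definition two_runs :: "nat \<Rightarrow> (nat \<Rightarrow> nat) \<Rightarrow> (nat \<times> nat) set" where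
  "two_runs k i = {(a, l). a \<in> alphabet k \<and> l \<ge> 1 \<and> i l = a \<and> i (l + 1) = a}"


section \<open>Shift-invariant measures\<close>

definition shift :: "(int \<Rightarrow> nat) \<Rightarrow> int \<Rightarrow> nat" where
  "shift x = (\<lambda>n. x (n + 1))"

text \<open>Here \<open>borel\<close> comes from the product topology on \<open>int \<Rightarrow> nat\<close> with \<open>nat\<close> discrete.\<close>

definition invariant_prob :: "(int \<Rightarrow> nat) set \<Rightarrow> (int \<Rightarrow> nat) measure \<Rightarrow> bool" where
  "invariant_prob X \<nu> \<longleftrightarrow>
     prob_space \<nu> \<and>
     sets \<nu> = sets (restrict_space borel X) \<and>
     shift \<in> measurable \<nu> \<nu> \<and>
     distr \<nu> \<nu> shift = \<nu>"

definition unique_invariant_prob :: "(int \<Rightarrow> nat) set \<Rightarrow> (int \<Rightarrow> nat) measure \<Rightarrow> bool" where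
  "unique_invariant_prob X \<nu> \<longleftrightarrow>
     invariant_prob X \<nu> \<and> (\<forall>\<nu>'. invariant_prob X \<nu>' \<longrightarrow> \<nu>' = \<nu>)"


section \<open>Schroedinger operators on the square-summable sequences\<close>

definition ell2 :: "(int \<Rightarrow> complex) set" where
  "ell2 = {\<phi>. (\<lambda>n. (cmod (\<phi> n))\<^sup>2) summable_on UNIV}"

text \<open>Conjugate-linear in the first argument, as the sign in the defining identity of the spectral
  measures requires.\<close>

definition ell2_inner :: "(int \<Rightarrow> complex) \<Rightarrow> (int \<Rightarrow> complex) \<Rightarrow> complex" where
  "ell2_inner \<phi> \<psi> = (\<Sum>\<^sub>\<infinity>n\<in>UNIV. cnj (\<phi> n) * \<psi> n)"

definition ell2_norm :: "(int \<Rightarrow> complex) \<Rightarrow> real" where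
  "ell2_norm \<phi> = sqrt (\<Sum>\<^sub>\<infinity>n\<in>UNIV. (cmod (\<phi> n))\<^sup>2)"

type_synonym seq_operator = "(int \<Rightarrow> complex) \<Rightarrow> int \<Rightarrow> complex"

definition schroedinger :: "(nat \<Rightarrow> real) \<Rightarrow> (int \<Rightarrow> nat) \<Rightarrow> seq_operator" where
  "schroedinger f x \<phi> = (\<lambda>n. \<phi> (n + 1) + \<phi> (n - 1) + complex_of_real (f (x n)) * \<phi> n)"

definition minus_scalar :: "seq_operator \<Rightarrow> complex \<Rightarrow> seq_operator" where
  "minus_scalar T z \<phi> = (\<lambda>n. T \<phi> n - z * \<phi> n)"

definition resolvent_on :: "(int \<Rightarrow> complex) set \<Rightarrow> seq_operator \<Rightarrow> complex \<Rightarrow> seq_operator" where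
  "resolvent_on S T z = the_inv_into S (minus_scalar T z)"

text \<open>Spectrum of the restriction of \<open>T\<close> to an invariant subspace \<open>S\<close> of \<open>ell2\<close>. The inverse of a
  linear bijection is linear, so only its boundedness is required.\<close>

definition spectrum_on :: "(int \<Rightarrow> complex) set \<Rightarrow> seq_operator \<Rightarrow> complex set" where
  "spectrum_on S T =
     {z. \<not> (bij_betw (minus_scalar T z) S S \<and>
            (\<exists>C. \<forall>\<phi>\<in>S. ell2_norm (resolvent_on S T z \<phi>) \<le> C * ell2_norm \<phi>))}"

definition is_spectral_measure :: "seq_operator \<Rightarrow> (int \<Rightarrow> complex) \<Rightarrow> real measure \<Rightarrow> bool" where
  "is_spectral_measure T \<phi> \<mu> \<longleftrightarrow>
     sets \<mu> = sets borel \<and> finite_measure \<mu> \<and>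
     (\<forall>z. Im z > 0 \<longrightarrow>
        ell2_inner \<phi> (resolvent_on ell2 T z \<phi>) = (LINT t|\<mu>. 1 / (complex_of_real t - z)))"

definition pure_point :: "real measure \<Rightarrow> bool" where
  "pure_point \<mu> \<longleftrightarrow> (\<exists>C. countable C \<and> emeasure \<mu> (UNIV - C) = 0)"

text \<open>For bounded self-adjoint \<open>T\<close> every vector has exactly one spectral measure, so the existential
  quantifier merely names it. The zero measure counts as pure point, so the zero vector belongs to
  the pure point subspace.\<close>

definition pp_subspace :: "seq_operator \<Rightarrow> (int \<Rightarrow> complex) set" where
  "pp_subspace T = {\<phi> \<in> ell2. \<exists>\<mu>. is_spectral_measure T \<phi> \<mu> \<and> pure_point \<mu>}"

definition pp_spectrum :: "seq_operator \<Rightarrow> complex set" where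
  "pp_spectrum T = spectrum_on (pp_subspace T) T"

end

theory Submission
  imports Defs
begin

text \<open>
  The proof is Gordon's three-block argument. If the potential has period \<open>p\<close> on the window
  \<open>[m - p, m + 2 * p)\<close>, the transfer matrix over one period has determinant one, and the
  Cayley-Hamilton theorem applied to it shows that a solution of the eigenvalue equation cannot be
  small at all of \<open>m - p\<close>, \<open>m + p\<close>, \<open>m + 2 * p\<close> unless it is small at \<open>m\<close>
  (\<open>gordon_three_blocks\<close>). When such windows around one fixed \<open>m\<close> exist for arbitrarily large
  \<open>p\<close>, a square-summable solution vanishes at \<open>m\<close> and hence everywhere (\<open>no_eigenvector\<close>).

  The combinatorial task is to produce three-block windows with a frequency that does not decay as
  \<open>p\<close> grows. Starting from the empty word one builds a chain of bispecial words: if \<open>w\<close> is bispecial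
  and \<open>R c @ w\<close> denotes the complete return to \<open>w\<close> that starts with \<open>w @ [c]\<close>, the next word in the
  chain is \<open>R a @ w\<close>, where \<open>a\<close> is the letter for which \<open>a # w\<close> is right special
  (\<open>return_system_step\<close>). The lengths at most double from one level to the next, up to an
  additive constant. Among any \<open>2 * k + 1\<close> consecutive levels some letter is chosen three times, at
  levels \<open>l < n < n'\<close>. Let \<open>p\<close> be the length of the return word of this letter at level \<open>n\<close>. The choice
  at \<open>n\<close> makes the square of that return word followed by \<open>W n\<close> a word of period \<open>p\<close>; the choice at \<open>l\<close> makes it
  longer than \<open>3 * p\<close> by at least the length of \<open>W l\<close>; the choice at \<open>n'\<close> embeds it into
  \<open>W (Suc n')\<close>, which recurs with gaps of the order of its own length. Since the lengths of
  \<open>W l\<close> and \<open>W (Suc n')\<close> are comparable, three-block windows have frequency at least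
  \<open>1 / 2 ^ (2 * k + 2)\<close> for arbitrarily large \<open>p\<close> (\<open>frequent_three_blocks\<close>).

  Hence the set of \<open>x\<close> that have three-block windows with arbitrarily large \<open>p\<close> around some common
  position has positive measure. It is shift-invariant, and a unique invariant measure is ergodic,
  so it has full measure (\<open>AE_three_blocks\<close>).

  It remains to see that a nonzero vector with pure point spectral measure forces an eigenvector.
  The measure has an atom \<open>E\<close>; the vectors \<open>\<epsilon> (H - E - \<i> \<epsilon>)\<^sup>-\<^sup>1 \<phi>\<close> are bounded, and by the
  Stieltjes identity their inner products with \<open>\<phi>\<close> tend to a nonzero multiple of the mass of the
  atom. A weak limit along a subsequence is therefore a nonzero eigenvector
  (\<open>eigenvector_of_atom\<close>).
\<close>


section \<open>Occurrences of words\<close>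

definition occurs_at :: "(int \<Rightarrow> nat) \<Rightarrow> int \<Rightarrow> nat list \<Rightarrow> bool" where
  "occurs_at x m u \<longleftrightarrow> (\<forall>j<length u. x (m + int j) = u ! j)"

lemma occurs_at_iff_word_at: "occurs_at x m u \<longleftrightarrow> word_at x m (length u) = u"
proof -
  have "word_at x m (length u) = u \<longleftrightarrow> (\<forall>j<length u. word_at x m (length u) ! j = u ! j)"
    by (subst list_eq_iff_nth_eq) (simp add: word_at_def)
  then show ?thesis by (simp add: occurs_at_def word_at_def)
qed

lemma occurs_at_Nil [simp]: "occurs_at x m []"
  by (simp add: occurs_at_def)

lemma occurs_at_append:
  "occurs_at x m (u @ v) \<longleftrightarrow> occurs_at x m u \<and> occurs_at x (m + int (length u)) v"
proof
  assume *: "occurs_at x m (u @ v)"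
  have "x (m + int j) = u ! j" if "j < length u" for j
    using *[unfolded occurs_at_def, rule_format, of j] that by (simp add: nth_append)
  moreover have "x (m + int (length u) + int j) = v ! j" if "j < length v" for j
    using *[unfolded occurs_at_def, rule_format, of "length u + j"] that
    by (simp add: nth_append add.assoc)
  ultimately show "occurs_at x m u \<and> occurs_at x (m + int (length u)) v"
    by (simp add: occurs_at_def)
next
  assume *: "occurs_at x m u \<and> occurs_at x (m + int (length u)) v"
  show "occurs_at x m (u @ v)"
    unfolding occurs_at_def
  proof (intro allI impI)
    fix j assume j: "j < length (u @ v)"
    show "x (m + int j) = (u @ v) ! j"
    proof (cases "j < length u")
      case True
      then show ?thesis using * by (simp add: occurs_at_def nth_append)
    next
      case False
      then obtain i where i: "j = length u + i" "i < length v"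
        using j by (metis add_diff_inverse_nat length_append nat_add_left_cancel_less)
      then show ?thesis
        using * by (simp add: occurs_at_def nth_append add.assoc)
    qed
  qed
qed

lemma occurs_at_Cons: "occurs_at x m (c # u) \<longleftrightarrow> x m = c \<and> occurs_at x (m + 1) u"
proof -
  have "occurs_at x m ([c] @ u) \<longleftrightarrow> occurs_at x m [c] \<and> occurs_at x (m + int (length [c])) u"
    by (rule occurs_at_append)
  then show ?thesis by (simp add: occurs_at_def[of x m "[c]"])
qed

section \<open>Special factors of Arnoux-Rauzy languages\<close>

lemma fibre_card:
  fixes g :: "'a \<Rightarrow> 'b"
  assumes "finite A" and "finite B" and "g ` A = B" and "r \<in> B"
    and "card A = card B + d"
    and inj: "\<And>a a'. a \<in> A \<Longrightarrow> a' \<in> A \<Longrightarrow> g a = g a' \<Longrightarrow> g a \<noteq> r \<Longrightarrow> a = a'"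
  shows "card {a \<in> A. g a = r} = d + 1"
proof -
  let ?F = "{a \<in> A. g a = r}"
  have "inj_on g (A - ?F)"
    by (rule inj_onI) (metis (mono_tags, lifting) DiffE inj mem_Collect_eq)
  moreover have "g ` (A - ?F) = B - {r}"
    using assms(3) by auto
  ultimately have "card (A - ?F) = card (B - {r})"
    by (metis card_image)
  then have "card A - card ?F = card B - 1"
    using assms by (simp add: card_Diff_subset)
  moreover have "card ?F \<le> card A"
    using assms(1) by (intro card_mono) auto
  moreover have "card B > 0"
    using assms(2,4) by (auto simp: card_gt_0_iff)
  ultimately show ?thesis
    using assms(5) by linarith
qed

text \<open>
  The common language of a two-sided subshift. Keeping it separate from the generating
  sequence treats one-sided and two-sided generators alike, and all words below depend on the language
  alone, so that one choice works simultaneously for every point of the subshift.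
\<close>
locale arnoux_rauzy_language =
  fixes k :: nat and X :: "(int \<Rightarrow> nat) set" and L :: "nat list set"
  assumes two_letters: "2 \<le> k"
    and inhabited: "X \<noteq> {}"
    and language: "x \<in> X \<Longrightarrow> u \<in> L \<longleftrightarrow> (\<exists>m. occurs_at x m u)"
    and letters: "u \<in> L \<Longrightarrow> set u \<subseteq> {1..k}"
    and complexity: "card {u \<in> L. length u = n} = (k - 1) * n + 1"
    and right_special_unique:
      "right_special L u \<Longrightarrow> right_special L v \<Longrightarrow> length u = length v \<Longrightarrow> u = v"
    and right_special_exists: "n \<ge> 1 \<Longrightarrow> \<exists>u. length u = n \<and> right_special L u"
    and left_special_unique:
      "left_special L u \<Longrightarrow> left_special L v \<Longrightarrow> length u = length v \<Longrightarrow> u = v"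
    and left_special_exists: "n \<ge> 1 \<Longrightarrow> \<exists>u. length u = n \<and> left_special L u"
    and recurrence: "u \<in> L \<Longrightarrow> \<exists>r::nat. \<forall>x\<in>X. \<forall>m. \<exists>j\<le>r. occurs_at x (m + int j) u"
begin

lemma occurs_at_in_language: "x \<in> X \<Longrightarrow> occurs_at x m u \<Longrightarrow> u \<in> L"
  by (subst language) (assumption, rule exI)

lemma letter_in_alphabet: "x \<in> X \<Longrightarrow> x m \<in> {1..k}"
proof -
  assume "x \<in> X"
  moreover have "occurs_at x m [x m]" by (simp add: occurs_at_def)
  ultimately have "[x m] \<in> L" by (rule occurs_at_in_language)
  from letters[OF this] show ?thesis by simp
qed

lemma factorial:
  assumes "u @ v \<in> L" shows "u \<in> L" "v \<in> L"
proof -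
  obtain x where "x \<in> X" using inhabited by blast
  with assms language obtain m where "occurs_at x m (u @ v)" by blast
  then show "u \<in> L" "v \<in> L"
    using occurs_at_append occurs_at_in_language[OF \<open>x \<in> X\<close>] by blast+
qed

lemma extendable:
  assumes "u \<in> L" shows "\<exists>c. u @ [c] \<in> L" "\<exists>c. c # u \<in> L"
proof -
  obtain x where x: "x \<in> X" using inhabited by blast
  with assms language obtain m where m: "occurs_at x m u" by blast
  then have "occurs_at x m (u @ [x (m + int (length u))])"
    by (simp add: occurs_at_append occurs_at_Cons)
  then show "\<exists>c. u @ [c] \<in> L"
    using occurs_at_in_language[OF x] by blast
  have "occurs_at x (m - 1) (x (m - 1) # u)"
    using m by (simp add: occurs_at_Cons)
  then show "\<exists>c. c # u \<in> L"
    using occurs_at_in_language[OF x] by blast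
qed

lemma finite_words: "finite {u \<in> L. length u = n}"
proof (rule ccontr)
  assume "infinite {u \<in> L. length u = n}"
  then show False using complexity[of n] by simp
qed

text \<open>
  Passing from length \<open>n\<close> to \<open>n + 1\<close> the complexity grows by \<open>k - 1\<close>. Only one word of length \<open>n\<close> has
  more than one right extension, so it accounts for the whole increase and has all \<open>k\<close> of them.
\<close>
lemma right_special_extensions:
  assumes r: "right_special L r" and c: "c \<in> {1..k}"
  shows "r @ [c] \<in> L"
proof -
  let ?n = "length r"
  let ?A = "{u \<in> L. length u = Suc ?n}" and ?B = "{u \<in> L. length u = ?n}"
  have "card {u \<in> ?A. butlast u = r} = (k - 1) + 1"
  proof (rule fibre_card)
    show "finite ?A" "finite ?B" by (rule finite_words)+
    show "butlast ` ?A = ?B"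
    proof
      show "butlast ` ?A \<subseteq> ?B"
      proof
        fix v assume "v \<in> butlast ` ?A"
        then obtain u where u: "u \<in> L" "length u = Suc ?n" "v = butlast u" by blast
        then have "u = v @ [last u]" by (metis append_butlast_last_id list.size(3) nat.distinct(1))
        then show "v \<in> ?B" using u factorial(1) by (metis (mono_tags) diff_Suc_1 length_butlast mem_Collect_eq)
      qed
      show "?B \<subseteq> butlast ` ?A"
      proof
        fix v assume v: "v \<in> ?B"
        then obtain d where "v @ [d] \<in> L" using extendable by blast
        then show "v \<in> butlast ` ?A" using v by (intro image_eqI[of _ _ "v @ [d]"]) auto
      qed
    qed
    show "r \<in> ?B" using r by (simp add: right_special_def)
    show "card ?A = card ?B + (k - 1)" unfolding complexity by simp
    fix a a' assume a: "a \<in> ?A" "a' \<in> ?A" "butlast a = butlast a'" "butlast a \<noteq> r"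
    have eq: "a = butlast a @ [last a]" "a' = butlast a @ [last a']"
      using a by (metis (mono_tags, lifting) append_butlast_last_id length_0_conv mem_Collect_eq nat.distinct(1))+
    show "a = a'"
    proof (rule ccontr)
      assume "a \<noteq> a'"
      then have "last a \<noteq> last a'" using eq by metis
      moreover have "butlast a @ [last a] \<in> L" "butlast a @ [last a'] \<in> L" using eq a by auto
      moreover have "butlast a \<in> L" using \<open>butlast a @ [last a] \<in> L\<close> factorial(1) by blast
      ultimately have "right_special L (butlast a)" unfolding right_special_def by blast
      then show False using right_special_unique[OF _ r] a by simp
    qed
  qed
  note card = this
  have sub: "{u \<in> ?A. butlast u = r} \<subseteq> (\<lambda>c. r @ [c]) ` {c \<in> {1..k}. r @ [c] \<in> L}"
  proof
    fix u assume u: "u \<in> {u \<in> ?A. butlast u = r}"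
    then have eq: "u = r @ [last u]"
      by (metis (mono_tags, lifting) append_butlast_last_id length_0_conv mem_Collect_eq nat.distinct(1))
    have "set u \<subseteq> {1..k}" using u letters by blast
    then have "last u \<in> {1..k}" using eq by (metis in_set_conv_decomp subsetD)
    then show "u \<in> (\<lambda>c. r @ [c]) ` {c \<in> {1..k}. r @ [c] \<in> L}"
      using u eq by (intro image_eqI[of _ _ "last u"]) auto
  qed
  have "k \<le> card ((\<lambda>c. r @ [c]) ` {c \<in> {1..k}. r @ [c] \<in> L})"
    using card_mono[OF _ sub] card two_letters by simp
  also have "\<dots> \<le> card {c \<in> {1..k}. r @ [c] \<in> L}"
    by (rule card_image_le) auto
  finally have "{c \<in> {1..k}. r @ [c] \<in> L} = {1..k}"
    by (intro card_seteq) auto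
  then show ?thesis using c by blast
qed

lemma left_special_extensions:
  assumes r: "left_special L r" and c: "c \<in> {1..k}"
  shows "c # r \<in> L"
proof -
  let ?n = "length r"
  let ?A = "{u \<in> L. length u = Suc ?n}" and ?B = "{u \<in> L. length u = ?n}"
  have "card {u \<in> ?A. tl u = r} = (k - 1) + 1"
  proof (rule fibre_card)
    show "finite ?A" "finite ?B" by (rule finite_words)+
    show "tl ` ?A = ?B"
    proof
      show "tl ` ?A \<subseteq> ?B"
      proof
        fix v assume "v \<in> tl ` ?A"
        then obtain d where "d # v \<in> L" "length v = ?n" by (auto simp: length_Suc_conv)
        then show "v \<in> ?B" using factorial(2)[of "[d]"] by simp
      qed
      show "?B \<subseteq> tl ` ?A"
      proof
        fix v assume v: "v \<in> ?B"
        then obtain d where "d # v \<in> L" using extendable by blast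
        then show "v \<in> tl ` ?A" using v by (intro image_eqI[of _ _ "d # v"]) auto
      qed
    qed
    show "r \<in> ?B" using r by (simp add: left_special_def)
    show "card ?A = card ?B + (k - 1)" unfolding complexity by simp
    fix a a' assume a: "a \<in> ?A" "a' \<in> ?A" "tl a = tl a'" "tl a \<noteq> r"
    then obtain d d' v where d: "a = d # v" "a' = d' # v" "length v = ?n"
      by (auto simp: length_Suc_conv)
    show "a = a'"
    proof (rule ccontr)
      assume "a \<noteq> a'"
      then have "left_special L v"
        using a d factorial(2)[of "[d]" v] unfolding left_special_def by auto
      then show False using left_special_unique[OF _ r] a d by simp
    qed
  qed
  note card = this
  have sub: "{u \<in> ?A. tl u = r} \<subseteq> (\<lambda>c. c # r) ` {c \<in> {1..k}. c # r \<in> L}"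
    using letters by (force simp: length_Suc_conv)
  have "k \<le> card ((\<lambda>c. c # r) ` {c \<in> {1..k}. c # r \<in> L})"
    using card_mono[OF _ sub] card two_letters by simp
  also have "\<dots> \<le> card {c \<in> {1..k}. c # r \<in> L}"
    by (rule card_image_le) auto
  finally have "{c \<in> {1..k}. c # r \<in> L} = {1..k}"
    by (intro card_seteq) auto
  then show ?thesis using c by blast
qed

text \<open>
  A long enough \<open>p\<close>-periodic word contains every factor of length \<open>p\<close> by recurrence, but it has at
  most \<open>p\<close> of them, whereas the language has at least \<open>p + 1\<close>.
\<close>
lemma no_long_periodic_word:
  assumes "p \<ge> 1"
  shows "\<exists>N. \<forall>x\<in>X. \<forall>m. \<exists>j<N. x (m + int j + int p) \<noteq> x (m + int j)"
proof -
  let ?W = "{u \<in> L. length u = p}"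
  have "\<forall>u\<in>?W. \<exists>r::nat. \<forall>x\<in>X. \<forall>m. \<exists>j\<le>r. occurs_at x (m + int j) u"
    using recurrence by blast
  then obtain r :: "nat list \<Rightarrow> nat"
    where r: "\<And>u x m. u \<in> ?W \<Longrightarrow> x \<in> X \<Longrightarrow> \<exists>j\<le>r u. occurs_at x (m + int j) u"
    by metis
  define N where "N = Max (r ` ?W) + p"
  have rN: "r u + p \<le> N" if "u \<in> ?W" for u
    unfolding N_def using that finite_words[of p] by (simp add: Max_ge)
  have False if x: "x \<in> X" and per: "\<And>j. j < N \<Longrightarrow> x (m + int j + int p) = x (m + int j)" for x m
  proof -
    have fold: "x (m + int j) = x (m + int (j mod p))" if "j \<le> N" for j
      using that
    proof (induction j rule: less_induct)
      case (less j)
      show ?case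
      proof (cases "j < p")
        case False
        then have "m + int (j - p) + int p = m + int j" by simp
        moreover have "j - p < N" using less.prems False assms by linarith
        ultimately have "x (m + int j) = x (m + int (j - p))"
          using per[of "j - p"] by simp
        also have "\<dots> = x (m + int ((j - p) mod p))"
          using less.IH[of "j - p"] \<open>j - p < N\<close> assms False by linarith
        also have "(j - p) mod p = j mod p"
          using False by (simp add: le_mod_geq)
        finally show ?thesis .
      qed simp
    qed
    have "?W \<subseteq> (\<lambda>i. map (\<lambda>l. x (m + int ((i + l) mod p))) [0..<p]) ` {..<p}"
    proof
      fix u assume u: "u \<in> ?W"
      then obtain j where j: "j \<le> r u" "occurs_at x (m + int j) u"
        using r x by blast
      have "u ! l = x (m + int ((j mod p + l) mod p))" if "l < p" for l
      proof -
        have "u ! l = x (m + int (j + l))"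
          using j u that by (simp add: occurs_at_def add.assoc)
        also have "\<dots> = x (m + int ((j + l) mod p))"
          using fold[of "j + l"] rN[OF u] j that by linarith
        finally show ?thesis by (simp add: mod_add_left_eq)
      qed
      then have "u = map (\<lambda>l. x (m + int ((j mod p + l) mod p))) [0..<p]"
        using u by (intro nth_equalityI) auto
      then show "u \<in> (\<lambda>i. map (\<lambda>l. x (m + int ((i + l) mod p))) [0..<p]) ` {..<p}"
        using assms by (intro image_eqI[of _ _ "j mod p"]) auto
    qed
    then have "card ?W \<le> card {..<p}"
      by (rule surj_card_le[rotated]) simp
    moreover have "p \<le> (k - 1) * p"
      using mult_right_mono[of 1 "k - 1" p] two_letters by linarith
    ultimately show False
      unfolding complexity card_lessThan by linarith
  qed
  then show ?thesis by blast
qed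

section \<open>Return words to bispecial factors\<close>

text \<open>
  The word \<open>R c @ w\<close> is the complete return to \<open>w\<close> whose first occurrence of \<open>w\<close> is followed by \<open>c\<close>.
  The definition asks only for what an induction along the bispecial words can carry: that \<open>w @ [c]\<close>
  forces \<open>R c @ w\<close> to the right and that \<open>c # w\<close> forces the same word to the left. That the letter
  after the first \<open>w\<close> and the letter before the last \<open>w\<close> coincide stands in for the closure of the
  language under reversal.
\<close>
definition return_system :: "nat list \<Rightarrow> (nat \<Rightarrow> nat list) \<Rightarrow> bool" where
  "return_system w R \<longleftrightarrow>
     bispecial L w \<and>
     (\<forall>c\<in>{1..k}.
        R c \<noteq> [] \<and> length (R c) \<le> length w + 1 \<and>
        (\<exists>s. R c @ w = w @ c # s) \<and> last (R c) = c \<and>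
        (\<forall>x\<in>X. \<forall>m. occurs_at x m (w @ [c]) \<longrightarrow> occurs_at x m (R c @ w)) \<and>
        (\<forall>x\<in>X. \<forall>m. occurs_at x m (c # w) \<longrightarrow>
            occurs_at x (m + 1 - int (length (R c))) (R c @ w)))"

lemma return_systemD:
  assumes "return_system w R" and "c \<in> {1..k}"
  shows "R c \<noteq> []" "length (R c) \<le> length w + 1" "\<exists>s. R c @ w = w @ c # s" "last (R c) = c"
    and "\<And>x m. x \<in> X \<Longrightarrow> occurs_at x m (w @ [c]) \<Longrightarrow> occurs_at x m (R c @ w)"
    and "\<And>x m. x \<in> X \<Longrightarrow> occurs_at x m (c # w) \<Longrightarrow>
           occurs_at x (m + 1 - int (length (R c))) (R c @ w)"
  using assms unfolding return_system_def by auto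

lemma right_special_suffix:
  assumes "right_special L (u @ v)" shows "right_special L v"
  using assms factorial(2)[of u v] factorial(2)[of u "v @ [_]"] unfolding right_special_def
  by (metis append_assoc)

lemma left_special_prefix:
  assumes "left_special L (u @ v)" shows "left_special L u"
  using assms factorial(1)[of u v] factorial(1)[of "_ # u" v] unfolding left_special_def
  by (metis append_Cons)

text \<open>
  The right special word that is one letter longer ends with a right special word of the length of \<open>w\<close>,
  which can only be \<open>w\<close>.
\<close>
lemma right_special_left_extension:
  assumes "right_special L w"
  obtains a where "a \<in> {1..k}" "right_special L (a # w)"
proof -
  obtain u where u: "length u = length w + 1" "right_special L u"
    using right_special_exists[of "length w + 1"] by auto
  then obtain a v where av: "u = [a] @ v" "length v = length w"
    by (auto simp: length_Suc_conv)
  then have "v = w"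
    using right_special_suffix[of "[a]" v] u assms right_special_unique by metis
  moreover have "a \<in> {1..k}"
    using letters[of u] u av by (auto simp: right_special_def)
  ultimately show thesis using that[of a] u av by simp
qed

lemma left_special_right_extension:
  assumes "left_special L w"
  obtains a where "a \<in> {1..k}" "left_special L (w @ [a])"
proof -
  obtain u where u: "length u = length w + 1" "left_special L u"
    using left_special_exists[of "length w + 1"] by auto
  then obtain v a where av: "u = v @ [a]" "length v = length w"
    by (metis add.commute length_append_singleton nat.inject plus_1_eq_Suc rev_exhaust list.size(3) Zero_not_Suc)
  then have "v = w"
    using left_special_prefix[of v "[a]"] u assms left_special_unique by metis
  moreover have "a \<in> {1..k}"
    using letters[of u] u av by (auto simp: left_special_def)
  ultimately show thesis using that[of a] u av by simp
qed

text \<open>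
  If the letters \<open>a\<close> and \<open>b\<close> differed, \<open>b # w\<close> would not be right special and so could only be followed
  by \<open>b\<close>, which does follow it as \<open>w @ [b]\<close> is left special. Since the return word starting with \<open>w @ [b]\<close> ends with \<open>b # w\<close>, it would be followed by
  itself for ever, and a half-line would be periodic.
\<close>
lemma special_letters_agree:
  assumes lev: "return_system w R"
    and a: "a \<in> {1..k}" "right_special L (a # w)"
    and b: "b \<in> {1..k}" "left_special L (w @ [b])"
  shows "a = b"
proof (rule ccontr)
  assume ne: "a \<noteq> b"
  note R = return_systemD[OF lev b(1)]
  let ?p = "length (R b)"
  have notrs: "\<not> right_special L (b # w)"
    using right_special_unique[OF a(2), of "b # w"] ne by auto
  have bwb: "b # w @ [b] \<in> L"
    using left_special_extensions[OF b(2) b(1)] by simp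
  have step: "occurs_at x (m + int ?p) (w @ [b])" if x: "x \<in> X" and o: "occurs_at x m (w @ [b])" for x m
  proof -
    have oR: "occurs_at x m (R b @ w)" using R(5) x o by blast
    define c where "c = x (m + int ?p + int (length w))"
    have snoc: "R b = butlast (R b) @ [b]" using R(1,4) by (metis append_butlast_last_id)
    have "occurs_at x m (R b @ w @ [c])"
      using oR by (auto simp: occurs_at_append occurs_at_Cons c_def)
    then have "occurs_at x m (butlast (R b) @ (b # w @ [c]))"
      using snoc by (metis append.assoc append_Cons append_Nil)
    then have "b # w @ [c] \<in> L"
      using x language[OF x, of "b # w @ [c]"] by (auto simp: occurs_at_append)
    then have "c = b"
      using bwb notrs factorial(1)[of "b # w" "[b]"] unfolding right_special_def by auto
    then show ?thesis
      using oR by (auto simp: occurs_at_append occurs_at_Cons c_def)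
  qed
  obtain x where x: "x \<in> X" using inhabited by blast
  have "w @ [b] \<in> L" using b(2) by (simp add: left_special_def)
  then obtain m where m: "occurs_at x m (w @ [b])" using language[OF x] by blast
  have iter: "occurs_at x (m + int (i * ?p)) (w @ [b])" for i
  proof (induction i)
    case (Suc i)
    from step[OF x Suc] show ?case by (simp add: algebra_simps)
  qed (use m in simp)
  have p: "?p \<ge> 1" using R(1) by (simp add: Suc_le_eq)
  have val: "x (m + int j) = R b ! (j mod ?p)" for j
  proof -
    have "occurs_at x (m + int (j div ?p * ?p)) (R b)"
      using R(5)[OF x iter[of "j div ?p"]] by (simp add: occurs_at_append)
    moreover have "j mod ?p < ?p" using p by (intro mod_less_divisor) linarith
    ultimately have "x (m + int (j div ?p * ?p) + int (j mod ?p)) = R b ! (j mod ?p)"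
      unfolding occurs_at_def by blast
    moreover have "int (j div ?p * ?p) + int (j mod ?p) = int j"
      by (metis div_mult_mod_eq of_nat_add)
    ultimately show ?thesis by (simp only: add.assoc)
  qed
  have "x (m + int j + int ?p) = x (m + int j)" for j
    using val[of j] val[of "j + ?p"] by (simp add: add.assoc)
  then show False
    using no_long_periodic_word[OF p] x by meson
qed

text \<open>
  Around \<open>w\<close> the letter \<open>a\<close> can be combined with any letter on the other side, and a
  letter different from \<open>a\<close> on one side forces \<open>a\<close> on the other. Therefore a return word \<open>R c\<close> with
  \<open>c \<noteq> a\<close> is always preceded and followed by \<open>R a\<close>, which makes \<open>R a @ R c\<close> the return word to \<open>R a @ w\<close>.
\<close>
lemma return_system_step:
  assumes lev: "return_system w R"
  shows "\<exists>a\<in>{1..k}. return_system (R a @ w) (\<lambda>c. if c = a then R a else R a @ R c)"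
proof -
  from lev have rs: "right_special L w" and ls: "left_special L w"
    by (simp_all add: return_system_def bispecial_def)
  obtain a where a: "a \<in> {1..k}" "right_special L (a # w)"
    using right_special_left_extension[OF rs] .
  obtain a' where a': "a' \<in> {1..k}" "left_special L (w @ [a'])"
    using left_special_right_extension[OF ls] .
  have "a' = a" using special_letters_agree[OF lev a a'] by simp
  note a' = a'[unfolded this]
  have awc: "a # w @ [c] \<in> L" if "c \<in> {1..k}" for c
    using right_special_extensions[OF a(2) that] by simp
  have cwa: "c # w @ [a] \<in> L" if "c \<in> {1..k}" for c
    using left_special_extensions[OF a'(2) that] by simp
  \<comment> \<open>a second right neighbour would make \<open>c # w\<close> right special beside \<open>a # w\<close>\<close>
  have follow: "d = a" if "c \<in> {1..k}" "c \<noteq> a" "c # w @ [d] \<in> L" for c d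
  proof (rule ccontr)
    assume "d \<noteq> a"
    then have "right_special L (c # w)"
      using cwa[OF that(1)] that(3) factorial(1)[of "c # w" "[a]"]
      unfolding right_special_def by auto
    then show False
      using right_special_unique[OF a(2), of "c # w"] that(2) by auto
  qed
  have precede: "d = a" if "c \<in> {1..k}" "c \<noteq> a" "d # w @ [c] \<in> L" for c d
  proof (rule ccontr)
    assume "d \<noteq> a"
    then have "left_special L (w @ [c])"
      using awc[OF that(1)] that(3) factorial(2)[of "[a]" "w @ [c]"]
      unfolding left_special_def by auto
    then show False
      using left_special_unique[OF a'(2), of "w @ [c]"] that(2) by auto
  qed
  note Ra = return_systemD[OF lev a(1)]
  have snoc: "R c = butlast (R c) @ [c]" if "c \<in> {1..k}" for c
    using return_systemD[OF lev that] by (metis append_butlast_last_id)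
  let ?w = "R a @ w"
  let ?R = "\<lambda>c. if c = a then R a else R a @ R c"
  have rs': "?w @ [c] \<in> L" if c: "c \<in> {1..k}" for c
  proof -
    obtain x where x: "x \<in> X" using inhabited by blast
    obtain m where m: "occurs_at x m ((a # w) @ [c])"
      using awc[OF c] language[OF x] by auto
    then have aw: "occurs_at x m (a # w)" and c: "x (m + 1 + int (length w)) = c"
      by (simp_all add: occurs_at_append occurs_at_Cons add.commute add.left_commute)
    have "occurs_at x (m + 1 - int (length (R a))) ((R a @ w) @ [c])"
      using Ra(6)[OF x aw] c by (simp add: occurs_at_append occurs_at_Cons)
    then show ?thesis using occurs_at_in_language[OF x] by blast
  qed
  have ls': "c # ?w \<in> L" if c: "c \<in> {1..k}" for c
  proof -
    obtain x where x: "x \<in> X" using inhabited by blast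
    obtain m where m: "occurs_at x m (c # w @ [a])"
      using cwa[OF c] language[OF x] by auto
    then have "occurs_at x m (c # ?w)"
      using Ra(5)[OF x] by (simp add: occurs_at_Cons)
    then show ?thesis using occurs_at_in_language[OF x] by blast
  qed
  \<comment> \<open>two letters that witness the multiple extensions\<close>
  have two: "1 \<in> {1..k}" "2 \<in> {1..k}" "(1::nat) \<noteq> 2" using two_letters by auto
  have bis: "bispecial L ?w"
    unfolding bispecial_def right_special_def left_special_def
    using rs'[OF two(1)] rs'[OF two(2)] ls'[OF two(1)] ls'[OF two(2)] two(3) factorial(1)[of ?w "[1]"]
    by blast
  obtain sa where sa: "R a @ w = w @ a # sa" using Ra(3) by blast
  have "?R c \<noteq> [] \<and> length (?R c) \<le> length ?w + 1 \<and>
        (\<exists>s. ?R c @ ?w = ?w @ c # s) \<and> last (?R c) = c \<and>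
        (\<forall>x\<in>X. \<forall>m. occurs_at x m (?w @ [c]) \<longrightarrow> occurs_at x m (?R c @ ?w)) \<and>
        (\<forall>x\<in>X. \<forall>m. occurs_at x m (c # ?w) \<longrightarrow>
            occurs_at x (m + 1 - int (length (?R c))) (?R c @ ?w))" if c: "c \<in> {1..k}" for c
  proof (intro conjI ballI allI impI)
    note Rc = return_systemD[OF lev c]
    obtain sc where sc: "R c @ w = w @ c # sc" using Rc(3) by blast
    show "?R c \<noteq> []" using Ra by simp
    show "length (?R c) \<le> length ?w + 1" using Ra(2) Rc(2) by auto
    show "\<exists>s. ?R c @ ?w = ?w @ c # s"
    proof (cases "c = a")
      case True
      then have "?R c @ ?w = R a @ (w @ a # sa)" by (simp add: sa)
      also have "\<dots> = ?w @ c # sa" by (simp only: True append_assoc)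
      finally show ?thesis by blast
    next
      case False
      then have "?R c @ ?w = R a @ R c @ (w @ a # sa)" by (simp only: if_False sa append_assoc)
      also have "\<dots> = R a @ (R c @ w) @ a # sa" by (simp only: append_assoc)
      also have "\<dots> = ?w @ c # (sc @ a # sa)" by (simp only: sc append_assoc append_Cons)
      finally show ?thesis by blast
    qed
    show "last (?R c) = c" using Ra Rc by simp
    fix x m assume x: "x \<in> X"
    show "occurs_at x m (?R c @ ?w)" if o: "occurs_at x m (?w @ [c])"
    proof -
      have 1: "occurs_at x m (R a @ R c @ w)"
        using o Rc(5)[OF x, of "m + int (length (R a))"] by (simp add: occurs_at_append)
      show ?thesis
      proof (cases "c = a")
        case False
        define d where "d = x (m + int (length (R a)) + int (length (R c)) + int (length w))"
        have "occurs_at x m (R a @ R c @ w @ [d])"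
          using 1 by (simp add: occurs_at_append occurs_at_Cons d_def)
        then have "occurs_at x m ((R a @ butlast (R c)) @ (c # w @ [d]))"
          using snoc[OF c] by (metis append.assoc append_Cons append_Nil)
        then have "c # w @ [d] \<in> L"
          using language[OF x, of "c # w @ [d]"] by (auto simp: occurs_at_append)
        then have "d = a" using follow[OF c False] by simp
        then have "occurs_at x (m + int (length (R a)) + int (length (R c))) (w @ [a])"
          using 1 by (simp add: occurs_at_append occurs_at_Cons d_def)
        then have "occurs_at x (m + int (length (R a)) + int (length (R c))) (R a @ w)"
          using Ra(5)[OF x] by blast
        then show ?thesis using False 1 by (simp add: occurs_at_append)
      qed (use 1 in simp)
    qed
    show "occurs_at x (m + 1 - int (length (?R c))) (?R c @ ?w)" if o: "occurs_at x m (c # ?w)"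
    proof -
      let ?n = "m + 1 - int (length (R c))"
      have "occurs_at x m (c # w @ a # sa)" using o by (simp add: sa)
      then have "occurs_at x m (c # w)"
        using occurs_at_append[of x m "c # w" "a # sa"] by simp
      then have 1: "occurs_at x ?n (R c @ w)" using Rc(6)[OF x] by blast
      moreover have "occurs_at x (m + 1) (R a @ w)" using o by (simp add: occurs_at_Cons)
      ultimately have 2: "occurs_at x ?n (R c @ R a @ w)" by (simp add: occurs_at_append)
      show ?thesis
      proof (cases "c = a")
        case False
        define d where "d = x (?n - 1)"
        have "occurs_at x ?n (w @ c # sc)" using 1 by (simp only: sc)
        then have wc: "occurs_at x ?n w" "occurs_at x (?n + int (length w)) [c]"
          by (simp_all add: occurs_at_append occurs_at_Cons)
        then have "occurs_at x (?n - 1) (d # w @ [c])"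
          by (simp add: occurs_at_append occurs_at_Cons d_def algebra_simps)
        then have "d # w @ [c] \<in> L" using occurs_at_in_language[OF x] by blast
        then have "d = a" using precede[OF c False] by simp
        then have "occurs_at x (?n - 1) (a # w)"
          using wc by (simp add: occurs_at_Cons d_def algebra_simps)
        then have "occurs_at x (?n - 1 + 1 - int (length (R a))) (R a @ w)"
          using Ra(6)[OF x] by blast
        then have "occurs_at x (?n - int (length (R a))) (R a @ w)"
          by (simp only: diff_add_cancel)
        then have "occurs_at x (?n - int (length (R a))) (R a @ R c @ R a @ w)"
          using 2 by (simp add: occurs_at_append)
        moreover have "?n - int (length (R a)) = m + 1 - int (length (?R c))"
          using False by simp
        ultimately show ?thesis using False by simp
      qed (use 2 in simp)
    qed
  qed
  then have "return_system ?w ?R"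
    using bis unfolding return_system_def by blast
  then show ?thesis using a(1) by blast
qed

lemma return_system_Nil: "return_system [] (\<lambda>c. [c])"
proof -
  have in_L: "[c] \<in> L" if c: "c \<in> {1..k}" for c
  proof -
    have sub: "{u \<in> L. length u = 1} \<subseteq> (\<lambda>c. [c]) ` {c \<in> {1..k}. [c] \<in> L}"
      using letters by (force simp: length_Suc_conv)
    have "k \<le> card {u \<in> L. length u = 1}" unfolding complexity using two_letters by simp
    also have "\<dots> \<le> card ((\<lambda>c. [c]) ` {c \<in> {1..k}. [c] \<in> L})"
      by (rule card_mono[OF _ sub]) simp
    also have "\<dots> \<le> card {c \<in> {1..k}. [c] \<in> L}" by (rule card_image_le) simp
    finally have "{c \<in> {1..k}. [c] \<in> L} = {1..k}" by (intro card_seteq) auto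
    then show ?thesis using c by blast
  qed
  have two: "1 \<in> {1..k}" "2 \<in> {1..k}" "(1::nat) \<noteq> 2" using two_letters by auto
  have "bispecial L []"
    unfolding bispecial_def right_special_def left_special_def append_Nil
    using in_L[OF two(1)] in_L[OF two(2)] two(3) factorial(1)[of "[]" "[1]"]
    by (metis append_Nil)
  then show ?thesis by (simp add: return_system_def)
qed

end

section \<open>Frequent three-block windows\<close>

text \<open>
  The sequence \<open>x\<close> has period \<open>p\<close> on \<open>[m - p, m + 2 * p)\<close>: one block to the left of \<open>m\<close> and two to the right.
\<close>
definition three_blocks :: "(int \<Rightarrow> nat) \<Rightarrow> int \<Rightarrow> nat \<Rightarrow> bool" where
  "three_blocks x m p \<longleftrightarrow> (\<forall>i. - int p \<le> i \<and> i < int p \<longrightarrow> x (m + i + int p) = x (m + i))"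

lemma three_indices_with_same_value:
  fixes a :: "nat \<Rightarrow> nat"
  assumes a: "\<And>n. a n \<in> {1..k}"
  obtains l m n where "s \<le> l" "l < m" "m < n" "n \<le> s + 2 * k" "a l = a m" "a n = a m"
proof -
  let ?I = "{s..s + 2 * k}"
  let ?F = "\<lambda>c. {n \<in> ?I. a n = c}"
  have "\<exists>c\<in>{1..k}. card (?F c) > 2"
  proof (rule ccontr)
    assume "\<not> ?thesis"
    then have le: "\<And>c. c \<in> {1..k} \<Longrightarrow> card (?F c) \<le> 2" by force
    have "?I = (\<Union>c\<in>{1..k}. ?F c)" using a by auto
    also have "card \<dots> \<le> (\<Sum>c\<in>{1..k}. card (?F c))"
      by (rule card_UN_le) simp
    also have "\<dots> \<le> (\<Sum>c\<in>{1..k}. 2)" by (rule sum_mono) (rule le)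
    finally show False by simp
  qed
  then obtain c where c: "card (?F c) > 2" by blast
  have fin: "finite (?F c)" by simp
  have ne: "?F c \<noteq> {}"
  proof
    assume "?F c = {}"
    with c show False by (simp only: card.empty)
  qed
  have "card {Min (?F c), Max (?F c)} \<le> 2" by (simp add: card_insert_if)
  then have "\<not> ?F c \<subseteq> {Min (?F c), Max (?F c)}"
    using c card_mono[of "{Min (?F c), Max (?F c)}" "?F c"] by fastforce
  then obtain m where m: "m \<in> ?F c" "m \<noteq> Min (?F c)" "m \<noteq> Max (?F c)" by blast
  have "Min (?F c) \<in> ?F c" "Max (?F c) \<in> ?F c" using Min_in[OF fin ne] Max_in[OF fin ne] by blast+
  moreover have "Min (?F c) < m" "m < Max (?F c)"
    using m Min_le[OF fin m(1)] Max_ge[OF fin m(1)] by linarith+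
  ultimately show thesis
    using that[of "Min (?F c)" m "Max (?F c)"] m(1) by simp
qed

text \<open>
  The bispecial words \<open>W n\<close> with their return words \<open>R n\<close>, obtained by iterating the step above. The
  letters \<open>a n\<close> are those chosen by the steps.
\<close>
locale return_system_chain = arnoux_rauzy_language +
  fixes W :: "nat \<Rightarrow> nat list" and R :: "nat \<Rightarrow> nat \<Rightarrow> nat list" and a :: "nat \<Rightarrow> nat"
  assumes return_systems: "return_system (W n) (R n)"
    and chosen_letter: "a n \<in> {1..k}"
    and W_Suc: "W (Suc n) = R n (a n) @ W n"
    and R_Suc: "R (Suc n) c = (if c = a n then R n (a n) else R n (a n) @ R n c)"
begin

lemma R_length:
  assumes "c \<in> {1..k}" shows "0 < length (R n c)" "length (R n c) \<le> length (W n) + 1"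
  using return_systemD(1,2)[OF return_systems assms] by auto

lemma length_W_Suc: "length (W (Suc n)) = length (R n (a n)) + length (W n)"
  by (simp add: W_Suc)

lemma length_W_ge: "n \<le> length (W n)"
proof (induction n)
  case (Suc n)
  then show ?case using R_length(1)[OF chosen_letter, of n n] length_W_Suc[of n] by linarith
qed simp

lemma length_W_growth: "length (W (n + d)) + 1 \<le> 2 ^ d * (length (W n) + 1)"
proof (induction d)
  case (Suc d)
  have "length (W (n + Suc d)) + 1 \<le> 2 * (length (W (n + d)) + 1)"
    using R_length(2)[OF chosen_letter, of "n + d" "n + d"] by (simp add: length_W_Suc)
  then show ?case using Suc by simp
qed simp

text \<open>
  Right after \<open>a m\<close> has been chosen the two sides are equal. A later step with another letter adds the
  same return word to both sides; a later step with \<open>a m\<close> lengthens only the right-hand side.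
\<close>
lemma length_R_after_choice:
  assumes "m < n" shows "length (R n (a m)) + length (W m) \<le> length (W n)"
proof -
  have "length (R (Suc m + d) (a m)) + length (W m) \<le> length (W (Suc m + d))" for d
  proof (induction d)
    case (Suc d)
    then show ?case by (auto simp: R_Suc W_Suc)
  qed (simp add: R_Suc W_Suc)
  from this[of "n - Suc m"] show ?thesis using assms by simp
qed

text \<open>
  With \<open>c = a m\<close> the left-hand side is \<open>W (Suc m)\<close>, so long periodic complete returns of earlier levels
  reappear inside the bispecial word created when their letter is chosen again.
\<close>
lemma complete_return_nested:
  assumes "c \<in> {1..k}" and "n \<le> m"
  shows "\<exists>s t. R m c @ W m = s @ (R n c @ W n) @ t"
  using assms(2)
proof (induction m rule: dec_induct)
  case base
  show ?case by (rule exI[of _ "[]"], rule exI[of _ "[]"]) simp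
next
  case (step m)
  then obtain s t where st: "R m c @ W m = s @ (R n c @ W n) @ t" by blast
  obtain t' where t': "R m (a m) @ W m = W m @ t'"
    using return_systemD(3)[OF return_systems chosen_letter] by blast
  show ?case
  proof (cases "c = a m")
    case True
    then have "R (Suc m) c @ W (Suc m) = R m c @ (R m c @ W m)" by (simp add: R_Suc W_Suc)
    also have "\<dots> = (R m c @ s) @ (R n c @ W n) @ t" by (simp only: st append_assoc)
    finally show ?thesis by blast
  next
    case False
    then have "R (Suc m) c @ W (Suc m) = R m (a m) @ R m c @ (R m (a m) @ W m)"
      by (simp add: R_Suc W_Suc)
    also have "\<dots> = R m (a m) @ (R m c @ W m) @ t'" by (simp only: t' append_assoc)
    also have "\<dots> = (R m (a m) @ s) @ (R n c @ W n) @ (t @ t')" by (simp only: st append_assoc)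
    finally show ?thesis by blast
  qed
qed

text \<open>
  From any occurrence of \<open>W n\<close> the return words lead to further ones in both directions, with steps of
  length at most \<open>length (W n) + 1\<close>.
\<close>
lemma occurrence_gap:
  assumes x: "x \<in> X"
  shows "\<exists>j\<le>length (W n). occurs_at x (m + int j) (W n)"
proof -
  let ?O = "\<lambda>q. occurs_at x q (W n)"
  have right: "\<exists>q'. ?O q' \<and> q < q' \<and> q' \<le> q + int (length (W n)) + 1" if "?O q" for q
  proof -
    define c where "c = x (q + int (length (W n)))"
    have c: "c \<in> {1..k}" unfolding c_def by (rule letter_in_alphabet[OF x])
    have "occurs_at x q (W n @ [c])" using that by (simp add: occurs_at_append occurs_at_Cons c_def)
    then have "occurs_at x q (R n c @ W n)" using return_systemD(5)[OF return_systems c x] by blast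
    then show ?thesis
      using R_length[OF c, of n] by (intro exI[of _ "q + int (length (R n c))"]) (simp add: occurs_at_append)
  qed
  have left: "\<exists>q'. ?O q' \<and> q' < q" if "?O q" for q
  proof -
    define c where "c = x (q - 1)"
    have c: "c \<in> {1..k}" unfolding c_def by (rule letter_in_alphabet[OF x])
    have "occurs_at x (q - 1) (c # W n)" using that by (simp add: occurs_at_Cons c_def)
    then have "occurs_at x (q - 1 + 1 - int (length (R n c))) (R n c @ W n)"
      using return_systemD(6)[OF return_systems c x] by blast
    then have "occurs_at x (q - int (length (R n c))) (R n c @ W n)" by simp
    then obtain s where "occurs_at x (q - int (length (R n c))) (W n @ c # s)"
      using return_systemD(3)[OF return_systems c] by metis
    then show ?thesis
      using R_length[OF c, of n] by (intro exI[of _ "q - int (length (R n c))"]) (simp add: occurs_at_append)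
  qed
  have "W n \<in> L" using return_systems[of n] by (simp add: return_system_def bispecial_def left_special_def)
  then obtain q0 where q0: "?O q0" using language[OF x] by blast
  have "\<exists>q. ?O q \<and> q \<le> q0 - int i" for i
  proof (induction i)
    case 0
    then show ?case using q0 by auto
  next
    case (Suc i)
    then obtain q where "?O q" "q \<le> q0 - int i" by blast
    with left[of q] show ?case by force
  qed
  \<comment> \<open>the last occurrence before \<open>m\<close>; the next one is the required one\<close>
  from this[of "nat (q0 - m + 1)"] obtain q1 where "?O q1" "q1 \<le> q0 - int (nat (q0 - m + 1))"
    by blast
  then have q1: "?O q1 \<and> q1 < m" by linarith
  obtain q where q: "?O q" "q < m" and least: "\<And>q'. ?O q' \<Longrightarrow> q' < m \<Longrightarrow> nat (m - q) \<le> nat (m - q')"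
    using ex_has_least_nat[of "\<lambda>q. ?O q \<and> q < m" q1 "\<lambda>q. nat (m - q)"] q1 by blast
  from right[OF q(1)] obtain q' where q': "?O q'" "q < q'" "q' \<le> q + int (length (W n)) + 1" by blast
  have "m \<le> q'"
  proof (rule ccontr)
    assume "\<not> m \<le> q'"
    then show False using least[OF q'(1)] q'(2) by linarith
  qed
  then show ?thesis
    using q' q by (intro exI[of _ "nat (q' - m)"]) auto
qed

text \<open>
  The word \<open>R n c @ W n\<close> both starts and ends with \<open>W n\<close>, so it has period \<open>length (R n c)\<close>, and
  another copy of \<open>R n c\<close> in front prolongs this period.
\<close>
lemma square_return_periodic:
  assumes o: "occurs_at x m (R n c @ R n c @ W n)" and c: "c \<in> {1..k}"
    and j: "j < length (R n c) + length (W n)"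
  shows "x (m + int j + int (length (R n c))) = x (m + int j)"
proof -
  obtain s where s: "R n c @ W n = W n @ c # s"
    using return_systemD(3)[OF return_systems c] by blast
  have "occurs_at x m (R n c @ W n @ c # s)" using o by (simp only: s)
  then have 1: "occurs_at x m (R n c @ W n)" by (simp add: occurs_at_append)
  have 2: "occurs_at x (m + int (length (R n c))) (R n c @ W n)"
    using o by (simp add: occurs_at_append)
  have "j < length (R n c @ W n)" using j by simp
  then have "x (m + int j) = (R n c @ W n) ! j" "x (m + int (length (R n c)) + int j) = (R n c @ W n) ! j"
    using 1 2 unfolding occurs_at_def by blast+
  then show ?thesis by (simp add: algebra_simps)
qed

text \<open>
  Here \<open>N\<close> is the length of a stretch that is certain to meet the long periodic word, and \<open>c\<close> is the
  number of consecutive centres of three-block windows in that word.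
\<close>
lemma frequent_three_blocks:
  "\<exists>p\<ge>P. \<exists>N c. 0 < N \<and> N \<le> 2 ^ (2 * k + 2) * c \<and>
     (\<forall>x\<in>X. \<exists>j. j + c \<le> N \<and> (\<forall>i<c. three_blocks x (int (j + i)) p))"
proof -
  have "\<forall>p\<in>{1..P}. \<exists>N. \<forall>x\<in>X. \<forall>m. \<exists>j<N. x (m + int j + int p) \<noteq> x (m + int j)"
    using no_long_periodic_word by simp
  then obtain M where M: "\<And>p x m. p \<in> {1..P} \<Longrightarrow> x \<in> X \<Longrightarrow>
      \<exists>j<M p. x (m + int j + int p) \<noteq> x (m + int j)"
    by metis
  \<comment> \<open>starting at level \<open>s\<close> rules out the periods up to \<open>P\<close>, as the periodic words get too long for them\<close>
  define s where "s = Max (insert 0 (M ` {1..P}))"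
  have Ms: "M p \<le> s" if "p \<in> {1..P}" for p
    unfolding s_def using that by (intro Max_ge) auto
  obtain l n n' where ln: "s \<le> l" "l < n" "n < n'" "n' \<le> s + 2 * k" "a l = a n" "a n' = a n"
    using three_indices_with_same_value[of a k s] chosen_letter by metis
  define p where "p = length (R n (a n))"
  define U where "U = R n (a n) @ R n (a n) @ W n"
  have p_le: "p + length (W l) \<le> length (W n)"
    unfolding p_def using length_R_after_choice[OF ln(2)] ln(5) by simp
  have p1: "p \<ge> 1" unfolding p_def using R_length(1)[OF chosen_letter, of n n] by linarith
  have "R (Suc n) (a n) @ W (Suc n) = U" by (simp add: U_def R_Suc W_Suc)
  moreover obtain u v where "R n' (a n) @ W n' = u @ (R (Suc n) (a n) @ W (Suc n)) @ v"
    using complete_return_nested[OF chosen_letter, of "Suc n" n' n] ln(3) by auto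
  ultimately have W_n': "W (Suc n') = u @ U @ v" by (simp add: W_Suc ln(6))
  have lenU: "length U = 2 * p + length (W n)" by (simp add: U_def p_def)
  have occ: "\<exists>j\<le>length (W (Suc n')). occurs_at x (int (j + length u)) U" if x: "x \<in> X" for x
    using occurrence_gap[OF x, of "Suc n'" 0] unfolding W_n' by (auto simp: occurs_at_append)
  have per: "x (m + int j + int p) = x (m + int j)"
    if "occurs_at x m U" "j < p + length (W n)" for x m j
    using square_return_periodic[OF that(1)[unfolded U_def] chosen_letter] that(2) by (simp add: p_def)
  have "P \<le> p"
  proof (rule ccontr)
    assume "\<not> P \<le> p"
    then have pP: "p \<in> {1..P}" using p1 by simp
    obtain x where x: "x \<in> X" using inhabited by blast
    obtain j where j: "occurs_at x (int j) U" using occ[OF x] by blast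
    have "M p \<le> length (W n)"
      using Ms[OF pP] ln(1,2) length_W_ge[of n] by linarith
    then show False
      using M[OF pP x, of "int j"] per[OF j] by (meson le_trans less_le_trans trans_le_add2)
  qed
  moreover define c where "c = length (W l) + 1"
  moreover define N where "N = 2 * (length (W (Suc n')) + 1)"
  moreover have "0 < N" by (simp add: N_def)
  moreover have "N \<le> 2 ^ (2 * k + 2) * c"
  proof -
    have "length (W (Suc n')) + 1 \<le> 2 ^ (Suc n' - l) * c"
      using length_W_growth[of l "Suc n' - l"] ln by (simp add: c_def)
    also have "\<dots> \<le> 2 ^ (2 * k + 1) * c"
      using ln by (intro mult_right_mono power_increasing) auto
    finally show ?thesis by (simp add: N_def)
  qed
  moreover have "\<exists>j. j + c \<le> N \<and> (\<forall>i<c. three_blocks x (int (j + i)) p)" if x: "x \<in> X" for x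
  proof -
    obtain j where j: "j \<le> length (W (Suc n'))" "occurs_at x (int (j + length u)) U"
      using occ[OF x] by blast
    have "three_blocks x (int (j + length u + p + i)) p" if "i < c" for i
      unfolding three_blocks_def
    proof (intro allI impI)
      fix t assume t: "- int p \<le> t \<and> t < int p"
      define h where "h = nat (int p + int i + t)"
      have h: "int h = int p + int i + t" using t by (simp add: h_def)
      then have "int h < int (p + length (W n))" using t that p_le by (simp add: c_def)
      then have "h < p + length (W n)" by linarith
      from per[OF j(2) this] show "x (int (j + length u + p + i) + t + int p) = x (int (j + length u + p + i) + t)"
        using h by (simp add: algebra_simps)
    qed
    moreover have "j + length u + p + c \<le> N"
      using j(1) lenU p_le W_n' by (simp add: N_def c_def)
    ultimately show ?thesis by blast
  qed
  ultimately show ?thesis by blast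
qed

end

context arnoux_rauzy_language
begin

lemma return_system_chain_exists: "\<exists>W R a. return_system_chain k X L W R a"
proof -
  define step where "step = (\<lambda>S. SOME a. a \<in> {1..k} \<and>
    return_system (snd S a @ fst S) (\<lambda>c. if c = a then snd S a else snd S a @ snd S c))"
  define advance where "advance = (\<lambda>S. (snd S (step S) @ fst S,
    \<lambda>c. if c = step S then snd S (step S) else snd S (step S) @ snd S c))"
  define S where "S = (\<lambda>n. (advance ^^ n) ([], \<lambda>c. [c]))"
  have S_0: "S 0 = ([], \<lambda>c. [c])" and S_Suc: "S (Suc n) = advance (S n)" for n
    by (simp_all add: S_def)
  have step: "step S \<in> {1..k} \<and> return_system (snd S (step S) @ fst S)
      (\<lambda>c. if c = step S then snd S (step S) else snd S (step S) @ snd S c)"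
    if "return_system (fst S) (snd S)" for S
    unfolding step_def by (rule someI_ex) (rule return_system_step[OF that, unfolded Bex_def])
  have sys: "return_system (fst (S n)) (snd (S n))" for n
  proof (induction n)
    case 0
    show ?case using return_system_Nil by (simp add: S_0)
  next
    case (Suc n)
    from step[OF this] show ?case by (simp add: S_Suc advance_def)
  qed
  have "return_system_chain k X L (\<lambda>n. fst (S n)) (\<lambda>n. snd (S n)) (\<lambda>n. step (S n))"
  proof unfold_locales
    show "return_system (fst (S n)) (snd (S n))" for n by (rule sys)
    show "step (S n) \<in> {1..k}" for n using step[OF sys] by blast
  qed (simp_all add: S_Suc advance_def)
  then show ?thesis by blast
qed

lemma three_blocks_frequent:
  "\<exists>p\<ge>P. \<exists>N c. 0 < N \<and> N \<le> 2 ^ (2 * k + 2) * c \<and>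
     (\<forall>x\<in>X. \<exists>j. j + c \<le> N \<and> (\<forall>i<c. three_blocks x (int (j + i)) p))"
proof -
  obtain W R a where "return_system_chain k X L W R a"
    using return_system_chain_exists by blast
  then show ?thesis by (rule return_system_chain.frequent_three_blocks)
qed

end

section \<open>The language of an Arnoux-Rauzy subshift\<close>

lemma word_at_subword:
  fixes x :: "'i::semiring_1 \<Rightarrow> nat"
  assumes "j + l \<le> n"
  shows "word_at x (m + of_nat j) l = take l (drop j (word_at x m n))"
  using assms by (intro nth_equalityI) (auto simp: word_at_def add.assoc)

text \<open>
  Recurrence passes from the generating sequence to all points with one and the same gap, since every
  window of a point is also a window of the generating sequence.
\<close>
lemma arnoux_rauzy_language_of_sequence:
  fixes x :: "'i::semiring_1 \<Rightarrow> nat"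
  assumes k: "k \<ge> 2" and AR: "AR_sequence k x" and X: "X = associated_subshift k x" and ne: "X \<noteq> {}"
  shows "arnoux_rauzy_language k X (factor_set x)"
proof -
  let ?L = "factor_set x"
  have len: "length u = n" if "u \<in> factors y n" for u n and y :: "'j::semiring_1 \<Rightarrow> nat"
    using that by (auto simp: factors_def word_at_def)
  have fac: "{u \<in> ?L. length u = n} = factors x n" for n
  proof
    show "{u \<in> ?L. length u = n} \<subseteq> factors x n"
    proof
      fix u assume u: "u \<in> {u \<in> ?L. length u = n}"
      then obtain i where i: "u \<in> factors x i" by (auto simp: factor_set_def)
      with len[OF i] u show "u \<in> factors x n" by simp
    qed
    show "factors x n \<subseteq> {u \<in> ?L. length u = n}"
      using len[of _ x n] unfolding factor_set_def by blast
  qed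
  have zero: "factors y 0 = {[]}" for y :: "'j::semiring_1 \<Rightarrow> nat"
    by (auto simp: factors_def word_at_def)
  have same: "factors y n = factors x n" if "y \<in> X" for y n
  proof (cases "n = 0")
    case True
    then show ?thesis by (simp add: zero)
  next
    case False
    then show ?thesis using that by (simp add: X associated_subshift_def)
  qed
  have lang: "u \<in> ?L \<longleftrightarrow> (\<exists>m. occurs_at y m u)" if y: "y \<in> X" for y u
  proof -
    have "u \<in> ?L \<longleftrightarrow> u \<in> factors y (length u)"
      using fac[of "length u"] same[OF y] by blast
    also have "\<dots> \<longleftrightarrow> (\<exists>m. occurs_at y m u)"
      unfolding occurs_at_iff_word_at factors_def by (metis (no_types, lifting) imageE rangeI)
    finally show ?thesis .
  qed
  have alph: "set u \<subseteq> {1..k}" if "u \<in> ?L" for u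
  proof -
    have "range x \<subseteq> {1..k}" using AR by (simp add: AR_sequence_def alphabet_def)
    moreover have "set u \<subseteq> range x"
      using that by (auto simp: factor_set_def factors_def word_at_def)
    ultimately show ?thesis by (rule subset_trans[rotated])
  qed
  have card: "card (factors x n) = (k - 1) * n + 1" for n
  proof (cases "n = 0")
    case True
    then show ?thesis by (simp add: zero)
  next
    case False
    then show ?thesis using AR by (simp add: AR_sequence_def)
  qed
  have special: "\<exists>!u. u \<in> factors x n \<and> right_special ?L u" "\<exists>!u. u \<in> factors x n \<and> left_special ?L u"
    if "n \<ge> 1" for n using AR that unfolding AR_sequence_def by blast+
  have rs: "right_special ?L u \<Longrightarrow> u \<in> factors x (length u)" for u
    using fac[of "length u"] by (auto simp: right_special_def)
  have ls: "left_special ?L u \<Longrightarrow> u \<in> factors x (length u)" for u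
    using fac[of "length u"] by (auto simp: left_special_def)
  have rec: "\<exists>r::nat. \<forall>y\<in>X. \<forall>m. \<exists>j\<le>r. occurs_at y (m + int j) u" if u: "u \<in> ?L" for u
  proof -
    obtain r :: nat where r: "\<And>m. \<exists>j\<le>r. word_at x (m + of_nat j) (length u) = u"
      using AR u unfolding AR_sequence_def uniformly_recurrent_def by blast
    have "\<exists>j\<le>r. occurs_at y (m + int j) u" if y: "y \<in> X" for y m
    proof -
      let ?n = "r + length u"
      have "word_at y m ?n \<in> factors x ?n"
        unfolding same[OF y, symmetric] by (simp add: factors_def)
      then obtain m' where m': "word_at y m ?n = word_at x m' ?n" by (auto simp: factors_def)
      obtain j where j: "j \<le> r" "word_at x (m' + of_nat j) (length u) = u" using r by blast
      have "word_at y (m + int j) (length u) = u"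
        using word_at_subword[of j "length u" ?n y m] word_at_subword[of j "length u" ?n x m'] j m' by simp
      then show ?thesis using j(1) by (auto simp: occurs_at_iff_word_at)
    qed
    then show ?thesis by blast
  qed
  show ?thesis
  proof
    show "2 \<le> k" "X \<noteq> {}" by (fact k ne)+
    show "card {u \<in> ?L. length u = n} = (k - 1) * n + 1" for n by (simp only: fac card)
    show "u = v" if "right_special ?L u" "right_special ?L v" "length u = length v" for u v
      using special(1)[of "length u"] rs[OF that(1)] rs[OF that(2)] that
      by (cases "length u = 0") (auto simp: Suc_le_eq)
    show "u = v" if "left_special ?L u" "left_special ?L v" "length u = length v" for u v
      using special(2)[of "length u"] ls[OF that(1)] ls[OF that(2)] that
      by (cases "length u = 0") (auto simp: Suc_le_eq)
    show "\<exists>u. length u = n \<and> right_special ?L u" if "n \<ge> 1" for n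
      using special(1)[OF that] len by blast
    show "\<exists>u. length u = n \<and> left_special ?L u" if "n \<ge> 1" for n
      using special(2)[OF that] len by blast
  qed (use lang alph rec in blast)+
qed

section \<open>Absence of eigenvectors\<close>

text \<open>
  The numbers \<open>a\<close>, \<open>b\<close>, \<open>c\<close>, \<open>d\<close> are the entries of the transfer matrix over \<open>q\<close> steps.
\<close>
lemma transfer_coefficients:
  fixes v :: "int \<Rightarrow> complex"
  shows "\<exists>a b c d. a * d - b * c = 1 \<and>
    (\<forall>u. (\<forall>j<q. u (int j + 1) = v (int j) * u (int j) - u (int j - 1)) \<longrightarrow>
       u (int q) = a * u 0 + b * u (-1) \<and> u (int q - 1) = c * u 0 + d * u (-1))"
proof (induction q)
  case 0
  show ?case by (rule exI[of _ 1], rule exI[of _ 0], rule exI[of _ 0], rule exI[of _ 1]) simp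
next
  case (Suc q)
  then obtain a b c d where det: "a * d - b * c = 1"
    and abcd: "\<And>u. (\<forall>j<q. u (int j + 1) = v (int j) * u (int j) - u (int j - 1)) \<Longrightarrow>
       u (int q) = a * u 0 + b * u (-1) \<and> u (int q - 1) = c * u 0 + d * u (-1)"
    by blast
  have "u (int (Suc q)) = (v (int q) * a - c) * u 0 + (v (int q) * b - d) * u (-1) \<and>
        u (int (Suc q) - 1) = a * u 0 + b * u (-1)"
    if u: "\<forall>j<Suc q. u (int j + 1) = v (int j) * u (int j) - u (int j - 1)" for u
  proof -
    have 1: "u (int q) = a * u 0 + b * u (-1)" "u (int q - 1) = c * u 0 + d * u (-1)"
      using abcd[of u] u by simp_all
    have "u (int q + 1) = v (int q) * u (int q) - u (int q - 1)" using u by blast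
    then show ?thesis using 1 by (simp add: algebra_simps)
  qed
  moreover have "(v (int q) * a - c) * b - (v (int q) * b - d) * a = 1"
    using det by (simp add: algebra_simps)
  ultimately show ?case by blast
qed

text \<open>
  By the Cayley-Hamilton theorem the vectors \<open>\<Phi> (j) = (\<psi> (j), \<psi> (j - 1))\<close> satisfy
  \<open>\<Phi> (m + 2 p) - t \<Phi> (m + p) + \<Phi> (m) = 0\<close> and \<open>\<Phi> (m + p) - t \<Phi> (m) + \<Phi> (m - p) = 0\<close> with the trace \<open>t\<close> of the
  transfer matrix over one period. The first relation bounds \<open>\<Phi> (m)\<close> if \<open>\<bar>t\<bar> \<le> 1\<close>, the second one
  otherwise.
\<close>
lemma gordon_three_blocks:
  fixes \<psi> :: "int \<Rightarrow> complex"
  assumes eig: "\<And>n. schroedinger f x \<psi> n = z * \<psi> n"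
    and per: "three_blocks x m p"
  defines "N \<equiv> \<lambda>n. cmod (\<psi> n) + cmod (\<psi> (n - 1))"
  shows "N m \<le> N (m - int p) + N (m + int p) + N (m + 2 * int p)"
proof -
  define v where "v = (\<lambda>j. z - complex_of_real (f (x (m + j))))"
  obtain a b c d where det: "a * d - b * c = 1"
    and abcd: "\<And>u. (\<forall>j<p. u (int j + 1) = v (int j) * u (int j) - u (int j - 1)) \<Longrightarrow>
       u (int p) = a * u 0 + b * u (-1) \<and> u (int p - 1) = c * u 0 + d * u (-1)"
    using transfer_coefficients[of p v] by blast
  have eig': "\<psi> (n + 1) = (z - complex_of_real (f (x n))) * \<psi> n - \<psi> (n - 1)" for n
    using eig[of n] by (simp add: schroedinger_def algebra_simps)
  have step: "\<psi> (m + s + int p) = a * \<psi> (m + s) + b * \<psi> (m + s - 1) \<and>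
      \<psi> (m + s + int p - 1) = c * \<psi> (m + s) + d * \<psi> (m + s - 1)"
    if s: "\<forall>j. 0 \<le> j \<and> j < int p \<longrightarrow> x (m + s + j) = x (m + j)" for s
  proof -
    have "\<psi> (m + s + (int j + 1)) = v (int j) * \<psi> (m + s + int j) - \<psi> (m + s + (int j - 1))"
      if "j < p" for j
    proof -
      have "x (m + s + int j) = x (m + int j)" using s that by simp
      then show ?thesis
        using eig'[of "m + s + int j"] by (simp add: v_def add.assoc diff_add_eq add_diff_eq)
    qed
    then show ?thesis
      using abcd[of "\<lambda>j. \<psi> (m + s + j)"] by (simp add: algebra_simps)
  qed
  have s0: "\<psi> (m + int p) = a * \<psi> m + b * \<psi> (m - 1)"
    "\<psi> (m + int p - 1) = c * \<psi> m + d * \<psi> (m - 1)"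
    using step[of 0] by simp_all
  have "\<forall>j. 0 \<le> j \<and> j < int p \<longrightarrow> x (m + int p + j) = x (m + j)"
  proof (intro allI impI)
    fix j assume "0 \<le> j \<and> j < int p"
    then have "x (m + j + int p) = x (m + j)" using per by (simp add: three_blocks_def)
    then show "x (m + int p + j) = x (m + j)" by (simp add: algebra_simps)
  qed
  from step[OF this]
  have s1: "\<psi> (m + 2 * int p) = a * \<psi> (m + int p) + b * \<psi> (m + int p - 1)"
    "\<psi> (m + 2 * int p - 1) = c * \<psi> (m + int p) + d * \<psi> (m + int p - 1)"
    by (simp_all add: algebra_simps)
  have "\<forall>j. 0 \<le> j \<and> j < int p \<longrightarrow> x (m + - int p + j) = x (m + j)"
  proof (intro allI impI)
    fix j assume "0 \<le> j \<and> j < int p"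
    then have "- int p \<le> j - int p \<and> j - int p < int p" by simp
    then have "x (m + (j - int p) + int p) = x (m + (j - int p))"
      using per unfolding three_blocks_def by blast
    then show "x (m + - int p + j) = x (m + j)" by (simp add: algebra_simps)
  qed
  from step[OF this]
  have s2: "\<psi> m = a * \<psi> (m - int p) + b * \<psi> (m - int p - 1)"
    "\<psi> (m - 1) = c * \<psi> (m - int p) + d * \<psi> (m - int p - 1)"
    by simp_all
  let ?t = "a + d"
  have ch: "x0 = ?t * x1 - x2" "y0 = ?t * y1 - y2"
    if "x1 = a * x0 + b * y0" "y1 = c * x0 + d * y0" "x2 = a * x1 + b * y1" "y2 = c * x1 + d * y1"
    for x0 y0 x1 y1 x2 y2
  proof -
    have "?t * x1 - x2 = (a * d - b * c) * x0" unfolding that by (simp add: algebra_simps)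
    then show "x0 = ?t * x1 - x2" by (simp add: det)
    have "?t * y1 - y2 = (a * d - b * c) * y0" unfolding that by (simp add: algebra_simps)
    then show "y0 = ?t * y1 - y2" by (simp add: det)
  qed
  show ?thesis
  proof (cases "cmod ?t \<le> 1")
    case True
    have le: "cmod u \<le> cmod u1 + cmod u2" if "u = ?t * u1 - u2" for u u1 u2
    proof -
      have "cmod u \<le> cmod ?t * cmod u1 + cmod u2"
        unfolding that by (metis norm_mult norm_triangle_ineq4)
      also have "\<dots> \<le> 1 * cmod u1 + cmod u2"
        using True by (intro add_right_mono mult_right_mono) auto
      finally show ?thesis by simp
    qed
    have "cmod (\<psi> m) \<le> cmod (\<psi> (m + int p)) + cmod (\<psi> (m + 2 * int p))"
      by (rule le) (rule ch(1)[OF s0 s1])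
    moreover have "cmod (\<psi> (m - 1)) \<le> cmod (\<psi> (m + int p - 1)) + cmod (\<psi> (m + 2 * int p - 1))"
      by (rule le) (rule ch(2)[OF s0 s1])
    ultimately show ?thesis
      using norm_ge_zero[of "\<psi> (m - int p)"] norm_ge_zero[of "\<psi> (m - int p - 1)"]
      unfolding N_def by linarith
  next
    case False
    have le: "cmod u1 \<le> cmod u + cmod u2" if "u = ?t * u1 - u2" for u u1 u2
    proof -
      have "1 * cmod u1 \<le> cmod ?t * cmod u1"
        using False by (intro mult_right_mono) auto
      also have "\<dots> = cmod (u + u2)" unfolding that by (simp add: norm_mult)
      also have "\<dots> \<le> cmod u + cmod u2" by (rule norm_triangle_ineq)
      finally show ?thesis by simp
    qed
    have "cmod (\<psi> m) \<le> cmod (\<psi> (m - int p)) + cmod (\<psi> (m + int p))"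
      by (rule le) (rule ch(1)[OF s2 s0])
    moreover have "cmod (\<psi> (m - 1)) \<le> cmod (\<psi> (m - int p - 1)) + cmod (\<psi> (m + int p - 1))"
      by (rule le) (rule ch(2)[OF s2 s0])
    ultimately show ?thesis
      using norm_ge_zero[of "\<psi> (m + 2 * int p)"] norm_ge_zero[of "\<psi> (m + 2 * int p - 1)"]
      unfolding N_def by linarith
  qed
qed

lemma ell2_finite_large:
  assumes "\<psi> \<in> ell2" and e: "e > 0"
  shows "finite {n. cmod (\<psi> n) \<ge> e}"
proof (rule ccontr)
  let ?S = "{n. cmod (\<psi> n) \<ge> e}"
  assume inf: "infinite ?S"
  from assms(1) have sm: "(\<lambda>n. (cmod (\<psi> n))\<^sup>2) summable_on UNIV" by (simp add: ell2_def)
  define T where "T = infsum (\<lambda>n. (cmod (\<psi> n))\<^sup>2) UNIV"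
  obtain q :: nat where q: "T < real q * e\<^sup>2"
    using e by (metis ex_less_of_nat_mult zero_less_power)
  obtain F where F: "finite F" "card F = q" "F \<subseteq> ?S"
    using infinite_arbitrarily_large[OF inf] by blast
  have "real q * e\<^sup>2 = (\<Sum>n\<in>F. e\<^sup>2)" by (simp add: F(2))
  also have "\<dots> \<le> (\<Sum>n\<in>F. (cmod (\<psi> n))\<^sup>2)"
    using F(3) e by (intro sum_mono power_mono) auto
  also have "\<dots> \<le> T"
    unfolding T_def by (rule finite_sum_le_infsum[OF sm F(1)]) auto
  finally show False using q by simp
qed

lemma solution_zero:
  fixes \<psi> :: "int \<Rightarrow> complex"
  assumes eig: "\<And>n. schroedinger f x \<psi> n = z * \<psi> n" and "\<psi> m = 0" "\<psi> (m - 1) = 0"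
  shows "\<psi> n = 0"
proof -
  have rec: "\<psi> (n + 1) + \<psi> (n - 1) = (z - complex_of_real (f (x n))) * \<psi> n" for n
    using eig[of n] by (simp add: schroedinger_def algebra_simps)
  have up: "\<psi> (m + int j) = 0 \<and> \<psi> (m + int j - 1) = 0" for j
  proof (induction j)
    case (Suc j)
    then show ?case using rec[of "m + int j"] by (simp add: algebra_simps)
  qed (use assms in simp)
  have down: "\<psi> (m - int j) = 0 \<and> \<psi> (m - int j - 1) = 0" for j
  proof (induction j)
    case (Suc j)
    have eq: "m - int (Suc j) = m - int j - 1" by simp
    have "\<psi> (m - int j - 1 - 1) = 0" using Suc rec[of "m - int j - 1"] by simp
    then show ?case unfolding eq using Suc by blast
  qed (use assms in simp)
  show ?thesis
  proof (cases "n \<ge> m")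
    case True
    then show ?thesis using up[of "nat (n - m)"] by simp
  next
    case False
    then show ?thesis using down[of "nat (m - n)"] by simp
  qed
qed

text \<open>
  A square-summable \<open>\<psi>\<close> is small far out, in particular near \<open>m - p\<close>, \<open>m + p\<close> and \<open>m + 2 * p\<close> for
  large \<open>p\<close>; hence it vanishes at \<open>m\<close> and \<open>m - 1\<close>.
\<close>
lemma no_eigenvector:
  fixes \<psi> :: "int \<Rightarrow> complex"
  assumes ell2: "\<psi> \<in> ell2" and eig: "\<And>n. schroedinger f x \<psi> n = z * \<psi> n"
    and cubes: "\<And>P. \<exists>p\<ge>P. three_blocks x m p"
  shows "\<psi> n = 0"
proof -
  have small: "cmod (\<psi> m) + cmod (\<psi> (m - 1)) \<le> 6 * e" if e: "e > 0" for e
  proof -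
    have fin: "finite {n. cmod (\<psi> n) \<ge> e}" by (rule ell2_finite_large[OF ell2 e])
    define B where "B = Max (insert 0 (abs ` {n. cmod (\<psi> n) \<ge> e}))"
    have far: "cmod (\<psi> n) \<le> e" if "\<bar>n\<bar> > B" for n
    proof (rule ccontr)
      assume "\<not> cmod (\<psi> n) \<le> e"
      then have "\<bar>n\<bar> \<le> B" unfolding B_def using fin by (intro Max_ge) auto
      with that show False by simp
    qed
    obtain p where p: "p \<ge> nat B + nat \<bar>m\<bar> + 3" "three_blocks x m p"
      using cubes by blast
    have *: "cmod (\<psi> (m - int p)) \<le> e" "cmod (\<psi> (m - int p - 1)) \<le> e"
      "cmod (\<psi> (m + int p)) \<le> e" "cmod (\<psi> (m + int p - 1)) \<le> e"
      "cmod (\<psi> (m + 2 * int p)) \<le> e" "cmod (\<psi> (m + 2 * int p - 1)) \<le> e"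
      by (rule far; use p(1) in linarith)+
    show ?thesis
      using gordon_three_blocks[OF eig p(2)] * by linarith
  qed
  have "cmod (\<psi> m) + cmod (\<psi> (m - 1)) \<le> 0"
  proof (rule field_le_epsilon)
    fix e :: real assume "e > 0"
    then show "cmod (\<psi> m) + cmod (\<psi> (m - 1)) \<le> 0 + e" using small[of "e / 6"] by simp
  qed
  then have "\<psi> m = 0" "\<psi> (m - 1) = 0"
    by (smt (verit) norm_ge_zero zero_less_norm_iff)+
  then show ?thesis by (rule solution_zero[OF eig])
qed

section \<open>Three-block windows around almost every point\<close>

text \<open>
  Conditioning \<open>\<nu>\<close> on an invariant event of positive measure gives an invariant probability measure,
  which is \<open>\<nu>\<close> itself by uniqueness.
\<close>
lemma invariant_event_full:
  assumes uniq: "unique_invariant_prob X \<nu>" and A: "A \<in> sets \<nu>"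
    and inv: "shift -` A \<inter> space \<nu> = A" and pos: "emeasure \<nu> A \<noteq> 0"
  shows "AE x in \<nu>. x \<in> A"
proof -
  from uniq have inv_nu: "invariant_prob X \<nu>" by (simp add: unique_invariant_prob_def)
  interpret prob_space \<nu> using inv_nu by (simp add: invariant_prob_def)
  have sets_nu: "sets \<nu> = sets (restrict_space borel X)"
    and shift: "shift \<in> measurable \<nu> \<nu>" and distr: "distr \<nu> \<nu> shift = \<nu>"
    using inv_nu by (simp_all add: invariant_prob_def)
  let ?U = "uniform_measure \<nu> A"
  have shiftU: "shift \<in> measurable ?U ?U"
    using shift by (subst measurable_cong_sets[of ?U \<nu> ?U \<nu>]) simp_all
  have "distr ?U ?U shift = ?U"
  proof (rule measure_eqI)
    fix B assume "B \<in> sets (distr ?U ?U shift)"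
    then have B: "B \<in> sets \<nu>" by simp
    then have pre: "shift -` B \<inter> space \<nu> \<in> sets \<nu>" using shift by (rule measurable_sets[rotated])
    have "emeasure (distr ?U ?U shift) B = emeasure \<nu> (A \<inter> (shift -` B \<inter> space \<nu>)) / emeasure \<nu> A"
      using B pre A shiftU by (simp add: emeasure_distr)
    also have "A \<inter> (shift -` B \<inter> space \<nu>) = shift -` (A \<inter> B) \<inter> space \<nu>"
      using inv sets.sets_into_space[OF A] by blast
    also have "emeasure \<nu> (shift -` (A \<inter> B) \<inter> space \<nu>) = emeasure (distr \<nu> \<nu> shift) (A \<inter> B)"
      using A B shift by (simp add: emeasure_distr)
    also have "emeasure (distr \<nu> \<nu> shift) (A \<inter> B) / emeasure \<nu> A = emeasure ?U B"
      unfolding distr using A B by simp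
    finally show "emeasure (distr ?U ?U shift) B = emeasure ?U B" .
  qed simp
  moreover have "prob_space ?U"
    by (rule prob_space_uniform_measure[OF pos]) simp
  ultimately have "invariant_prob X ?U"
    using shiftU sets_nu by (simp add: invariant_prob_def)
  then have "?U = \<nu>" using uniq unfolding unique_invariant_prob_def by blast
  moreover have "emeasure ?U A = 1"
    by (rule emeasure_uniform_measure_1[OF pos]) simp
  ultimately have "emeasure \<nu> A = 1" by simp
  then have "prob A = 1" by (simp add: measure_def)
  then show ?thesis using prob_eq_1[OF A] by blast
qed

lemma closed_three_blocks: "closed {x. three_blocks x m p}"
proof -
  have "{x. three_blocks x m p} =
      (\<Inter>i\<in>{i. - int p \<le> i \<and> i < int p}. {x. x (m + i + int p) = x (m + i)})"
    by (auto simp: three_blocks_def)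
  moreover have "closed {x :: int \<Rightarrow> nat. x a = x b}" for a b
    by (intro closed_Collect_eq continuous_on_product_coordinates)
  ultimately show ?thesis by auto
qed

text \<open>
  By invariance the measure of the set of points with a three-block window around \<open>0\<close> is the mean
  of the frequency of such windows along an orbit segment, and this frequency is bounded below for
  arbitrarily large \<open>p\<close>. So the upper limit of these sets has positive measure.
  Allowing any centre \<open>m\<close> makes the event invariant.
\<close>
lemma (in arnoux_rauzy_language) AE_three_blocks:
  assumes uniq: "unique_invariant_prob X \<nu>"
  shows "AE x in \<nu>. \<exists>m. \<forall>P. \<exists>p\<ge>P. three_blocks x m p"
proof -
  from uniq have inv_nu: "invariant_prob X \<nu>" by (simp add: unique_invariant_prob_def)
  interpret prob_space \<nu> using inv_nu by (simp add: invariant_prob_def)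
  have sets_nu: "sets \<nu> = sets (restrict_space borel X)"
    and shift: "shift \<in> measurable \<nu> \<nu>" and distr: "distr \<nu> \<nu> shift = \<nu>"
    using inv_nu by (simp_all add: invariant_prob_def)
  have space: "space \<nu> = X"
    using sets_eq_imp_space_eq[OF sets_nu] by (simp add: space_restrict_space)
  define E where "E = (\<lambda>m p. {x \<in> X. three_blocks x m p})"
  have E_sets [measurable]: "E m p \<in> sets \<nu>" for m p
  proof -
    have "E m p = X \<inter> {x. three_blocks x m p}" by (auto simp: E_def)
    moreover have "{x. three_blocks x m p} \<in> sets borel"
      by (intro borel_closed closed_three_blocks)
    ultimately show ?thesis unfolding sets_nu sets_restrict_space by (rule image_eqI)
  qed
  have shift_block: "three_blocks (shift x) m p \<longleftrightarrow> three_blocks x (m + 1) p" for x m p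
    unfolding three_blocks_def shift_def by (simp add: add.assoc add.commute add.left_commute)
  have shift_X: "shift x \<in> X" if "x \<in> X" for x
    using measurable_space[OF shift] that by (simp add: space)
  have E_Suc: "E (int (Suc j)) p = shift -` E (int j) p \<inter> space \<nu>" for j p
    using shift_X by (auto simp: E_def space shift_block add.commute)
  have prob_E: "prob (E (int j) p) = prob (E 0 p)" for j p
  proof (induction j)
    case (Suc j)
    have "prob (E (int (Suc j)) p) = measure (distr \<nu> \<nu> shift) (E (int j) p)"
      unfolding E_Suc using shift by (simp add: measure_distr)
    then show ?case using Suc by (simp add: distr)
  qed simp
  define \<delta> :: real where "\<delta> = 1 / 2 ^ (2 * k + 2)"
  have large: "\<exists>p\<ge>P. prob (E 0 p) \<ge> \<delta>" for P
  proof -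
    obtain p N c where p: "p \<ge> P" and N: "0 < N" "N \<le> 2 ^ (2 * k + 2) * c"
      and blocks: "\<And>x. x \<in> X \<Longrightarrow> \<exists>j. j + c \<le> N \<and> (\<forall>i<c. three_blocks x (int (j + i)) p)"
      using three_blocks_frequent[of P] by blast
    let ?g = "\<lambda>x. \<Sum>j<N. indicat_real (E (int j) p) x"
    have int: "integrable \<nu> (indicat_real (E (int j) p))" for j
      by (simp add: integrable_indicator_iff less_top[symmetric])
    have ge: "real c \<le> ?g x" if x: "x \<in> space \<nu>" for x
    proof -
      obtain j where j: "j + c \<le> N" "\<forall>i<c. three_blocks x (int (j + i)) p"
        using blocks x space by blast
      have in_E: "x \<in> E (int t) p" if "t \<in> {j..<j + c}" for t
      proof -
        have "t - j < c" "j + (t - j) = t" using that by auto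
        then show ?thesis using j(2) x space unfolding E_def by fastforce
      qed
      have "real c = (\<Sum>t\<in>{j..<j + c}. indicat_real (E (int t) p) x)"
        using in_E by simp
      also have "\<dots> \<le> ?g x"
        using j(1) by (intro sum_mono2) auto
      finally show ?thesis .
    qed
    have "real c \<le> (\<integral>x. ?g x \<partial>\<nu>)"
      using ge int by (intro integral_ge_const) auto
    also have "\<dots> = (\<Sum>j<N. prob (E (int j) p))"
      using int by simp
    also have "\<dots> = real N * prob (E 0 p)" by (simp add: prob_E)
    finally have 1: "real c \<le> real N * prob (E 0 p)" .
    have "real N \<le> 2 ^ (2 * k + 2) * real c"
      using N(2) by (metis of_nat_le_iff of_nat_mult of_nat_numeral of_nat_power)
    then have "\<delta> * real N \<le> real c" by (simp add: \<delta>_def field_simps)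
    also note 1
    finally have "\<delta> * real N \<le> prob (E 0 p) * real N" by (simp add: mult.commute)
    then have "\<delta> \<le> prob (E 0 p)" using N(1) by simp
    with p show ?thesis by blast
  qed
  define A where "A = {x \<in> X. \<exists>m::int. \<forall>P. \<exists>p\<ge>P. three_blocks x m p}"
  have A_eq: "A = (\<Union>m. \<Inter>P. \<Union>p\<in>{P..}. E m p)" by (auto simp: A_def E_def Bex_def) blast+
  have A_sets: "A \<in> sets \<nu>"
    unfolding A_eq by measurable
  have A_inv: "shift -` A \<inter> space \<nu> = A"
  proof -
    have "(\<exists>m. \<forall>P. \<exists>p\<ge>P. three_blocks x (m + 1) p) \<longleftrightarrow> (\<exists>m. \<forall>P. \<exists>p\<ge>P. three_blocks x m p)" for x
      by (metis diff_add_cancel)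
    then show ?thesis using shift_X by (auto simp: A_def space shift_block)
  qed
  let ?B = "\<lambda>P. \<Union>p\<in>{P..}. E 0 p"
  have B_sets: "?B P \<in> sets \<nu>" for P by measurable
  have "(\<lambda>P. prob (?B P)) \<longlonglongrightarrow> prob (\<Inter>P. ?B P)"
  proof (rule finite_Lim_measure_decseq)
    show "range ?B \<subseteq> events" using B_sets by blast
    show "decseq ?B" unfolding decseq_def by (intro allI impI UN_mono) auto
  qed
  moreover have "\<delta> \<le> prob (?B P)" for P
  proof -
    obtain p where "p \<ge> P" "\<delta> \<le> prob (E 0 p)" using large by blast
    moreover have "prob (E 0 p) \<le> prob (?B P)"
      using \<open>p \<ge> P\<close> B_sets by (intro finite_measure_mono) auto
    ultimately show ?thesis by simp
  qed
  ultimately have "\<delta> \<le> prob (\<Inter>P. ?B P)"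
    by (intro LIMSEQ_le_const) auto
  also have "\<dots> \<le> prob A"
    using A_sets by (intro finite_measure_mono) (auto simp: A_eq)
  finally have "prob A > 0" by (simp add: \<delta>_def less_le_trans[rotated])
  then have "emeasure \<nu> A \<noteq> 0" by (simp add: emeasure_eq_measure)
  from invariant_event_full[OF uniq A_sets A_inv this]
  show ?thesis by (rule AE_mp) (auto simp: A_def)
qed

section \<open>Square-summable sequences\<close>

abbreviation ell2_sqnorm :: "(int \<Rightarrow> complex) \<Rightarrow> real" where
  "ell2_sqnorm \<phi> \<equiv> (\<Sum>\<^sub>\<infinity>n\<in>UNIV. (cmod (\<phi> n))\<^sup>2)"

lemma ell2_has_sum: "\<phi> \<in> ell2 \<Longrightarrow> ((\<lambda>n. (cmod (\<phi> n))\<^sup>2) has_sum ell2_sqnorm \<phi>) UNIV"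
  by (simp add: ell2_def)

lemma ell2_sqnorm_nonneg: "0 \<le> ell2_sqnorm \<phi>"
  by (rule infsum_nonneg) simp

lemma sum_le_ell2_sqnorm:
  assumes "\<phi> \<in> ell2" "finite F" shows "(\<Sum>n\<in>F. (cmod (\<phi> n))\<^sup>2) \<le> ell2_sqnorm \<phi>"
  using assms by (intro finite_sum_le_infsum) (auto simp: ell2_def)

lemma norm_sq_le_ell2_sqnorm:
  assumes "\<phi> \<in> ell2" shows "(cmod (\<phi> n))\<^sup>2 \<le> ell2_sqnorm \<phi>"
  using sum_le_ell2_sqnorm[OF assms, of "{n}"] by simp

lemma ell2_if_bounded:
  assumes "\<And>F. finite F \<Longrightarrow> (\<Sum>n\<in>F. (cmod (\<phi> n))\<^sup>2) \<le> B"
  shows "\<phi> \<in> ell2" "ell2_sqnorm \<phi> \<le> B"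
proof -
  have "(\<lambda>n. (cmod (\<phi> n))\<^sup>2) summable_on UNIV"
    by (rule nonneg_bdd_above_summable_on) (use assms in \<open>auto intro!: bdd_aboveI2[where M = B]\<close>)
  then show "\<phi> \<in> ell2" by (simp add: ell2_def)
  then show "ell2_sqnorm \<phi> \<le> B"
    using assms by (intro infsum_le_finite_sums) (auto simp: ell2_def)
qed

lemma ell2_linear_combination:
  assumes \<phi>: "\<phi> \<in> ell2" and \<psi>: "\<psi> \<in> ell2"
  shows "(\<lambda>n. a * \<phi> n + b * \<psi> n) \<in> ell2"
proof (rule ell2_if_bounded(1))
  fix F :: "int set" assume F: "finite F"
  have "(cmod (a * \<phi> n + b * \<psi> n))\<^sup>2 \<le> 2 * (cmod a)\<^sup>2 * (cmod (\<phi> n))\<^sup>2 + 2 * (cmod b)\<^sup>2 * (cmod (\<psi> n))\<^sup>2" for n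
  proof -
    have "(cmod (a * \<phi> n + b * \<psi> n))\<^sup>2 \<le> (cmod (a * \<phi> n) + cmod (b * \<psi> n))\<^sup>2"
      by (intro power_mono norm_triangle_ineq) simp
    also have "\<dots> \<le> 2 * (cmod (a * \<phi> n))\<^sup>2 + 2 * (cmod (b * \<psi> n))\<^sup>2"
      using zero_le_power2[of "cmod (a * \<phi> n) - cmod (b * \<psi> n)"]
      by (simp add: power2_eq_square algebra_simps)
    finally show ?thesis by (simp add: norm_mult power_mult_distrib)
  qed
  then have "(\<Sum>n\<in>F. (cmod (a * \<phi> n + b * \<psi> n))\<^sup>2) \<le>
      (\<Sum>n\<in>F. 2 * (cmod a)\<^sup>2 * (cmod (\<phi> n))\<^sup>2 + 2 * (cmod b)\<^sup>2 * (cmod (\<psi> n))\<^sup>2)"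
    by (intro sum_mono)
  also have "\<dots> = 2 * (cmod a)\<^sup>2 * (\<Sum>n\<in>F. (cmod (\<phi> n))\<^sup>2) + 2 * (cmod b)\<^sup>2 * (\<Sum>n\<in>F. (cmod (\<psi> n))\<^sup>2)"
    by (simp add: sum.distrib sum_distrib_left)
  also have "\<dots> \<le> 2 * (cmod a)\<^sup>2 * ell2_sqnorm \<phi> + 2 * (cmod b)\<^sup>2 * ell2_sqnorm \<psi>"
    by (intro add_mono mult_left_mono sum_le_ell2_sqnorm \<phi> \<psi> F) simp_all
  finally show "(\<Sum>n\<in>F. (cmod (a * \<phi> n + b * \<psi> n))\<^sup>2) \<le> \<dots>" .
qed

lemma sum_translate_le_ell2_sqnorm:
  assumes "\<psi> \<in> ell2" "finite F"
  shows "(\<Sum>n\<in>F. (cmod (\<psi> (n + a)))\<^sup>2) \<le> ell2_sqnorm \<psi>"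
proof -
  have "(\<Sum>n\<in>F. (cmod (\<psi> (n + a)))\<^sup>2) = (\<Sum>n\<in>(\<lambda>n. n + a) ` F. (cmod (\<psi> n))\<^sup>2)"
    by (subst sum.reindex) (auto simp: inj_on_def)
  also have "\<dots> \<le> ell2_sqnorm \<psi>"
    using assms by (intro sum_le_ell2_sqnorm) auto
  finally show ?thesis .
qed

lemma ell2_translate:
  assumes "\<psi> \<in> ell2" shows "(\<lambda>n. \<psi> (n + a)) \<in> ell2"
  using sum_translate_le_ell2_sqnorm[OF assms] by (rule ell2_if_bounded(1))

lemma ell2_product_summable:
  assumes \<phi>: "\<phi> \<in> ell2" and \<psi>: "\<psi> \<in> ell2"
  shows "(\<lambda>n. cnj (\<phi> n) * \<psi> n) summable_on UNIV" "(\<lambda>n. cmod (cnj (\<phi> n) * \<psi> n)) summable_on UNIV"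
proof -
  show "(\<lambda>n. cmod (cnj (\<phi> n) * \<psi> n)) summable_on UNIV"
  proof (rule nonneg_bdd_above_summable_on)
    have "(\<Sum>n\<in>F. cmod (cnj (\<phi> n) * \<psi> n)) \<le> ell2_sqnorm \<phi> + ell2_sqnorm \<psi>" if F: "finite F" for F
    proof -
      have "cmod (cnj (\<phi> n) * \<psi> n) \<le> (cmod (\<phi> n))\<^sup>2 + (cmod (\<psi> n))\<^sup>2" for n
        using sum_squares_bound[of "cmod (\<phi> n)" "cmod (\<psi> n)"] mult_nonneg_nonneg[OF norm_ge_zero[of "\<phi> n"] norm_ge_zero[of "\<psi> n"]]
        unfolding norm_mult complex_mod_cnj by linarith
      then have "(\<Sum>n\<in>F. cmod (cnj (\<phi> n) * \<psi> n)) \<le> (\<Sum>n\<in>F. (cmod (\<phi> n))\<^sup>2 + (cmod (\<psi> n))\<^sup>2)"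
        by (intro sum_mono)
      also have "\<dots> \<le> ell2_sqnorm \<phi> + ell2_sqnorm \<psi>"
        unfolding sum.distrib by (intro add_mono sum_le_ell2_sqnorm \<phi> \<psi> F)
      finally show ?thesis .
    qed
    then show "bdd_above (sum (\<lambda>n. cmod (cnj (\<phi> n) * \<psi> n)) ` {F. F \<subseteq> UNIV \<and> finite F})"
      by (intro bdd_aboveI2) auto
  qed simp
  then show "(\<lambda>n. cnj (\<phi> n) * \<psi> n) summable_on UNIV" by (rule abs_summable_summable)
qed

section \<open>The resolvent of a Schroedinger operator\<close>

lemma schroedinger_sqnorm_bound:
  assumes \<psi>: "\<psi> \<in> ell2" and c: "\<And>n. \<bar>f (x n)\<bar> \<le> c"
  shows "schroedinger f x \<psi> \<in> ell2"
    and "ell2_sqnorm (schroedinger f x \<psi>) \<le> 3 * (2 + c\<^sup>2) * ell2_sqnorm \<psi>"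
proof -
  have "(\<Sum>n\<in>F. (cmod (schroedinger f x \<psi> n))\<^sup>2) \<le> 3 * (2 + c\<^sup>2) * ell2_sqnorm \<psi>"
    if F: "finite F" for F
  proof -
    have pt: "(cmod (schroedinger f x \<psi> n))\<^sup>2 \<le>
      3 * ((cmod (\<psi> (n + 1)))\<^sup>2 + (cmod (\<psi> (n + - 1)))\<^sup>2 + c\<^sup>2 * (cmod (\<psi> (n + 0)))\<^sup>2)" for n
    proof -
      define r s t where "r = cmod (\<psi> (n + 1))" and "s = cmod (\<psi> (n - 1))" and "t = c * cmod (\<psi> n)"
      have "cmod (complex_of_real (f (x n)) * \<psi> n) \<le> t"
        unfolding t_def norm_mult using c[of n] by (intro mult_right_mono) auto
      then have "cmod (schroedinger f x \<psi> n) \<le> r + s + t"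
        unfolding schroedinger_def r_def s_def
        by (meson add_mono norm_triangle_le order_refl)
      then have "(cmod (schroedinger f x \<psi> n))\<^sup>2 \<le> (r + s + t)\<^sup>2"
        by (intro power_mono) auto
      also have "\<dots> \<le> 3 * (r\<^sup>2 + s\<^sup>2 + t\<^sup>2)"
        using zero_le_power2[of "r - s"] zero_le_power2[of "r - t"] zero_le_power2[of "s - t"]
        by (simp add: power2_eq_square algebra_simps)
      finally show ?thesis by (simp add: r_def s_def t_def power_mult_distrib)
    qed
    have "(\<Sum>n\<in>F. (cmod (schroedinger f x \<psi> n))\<^sup>2) \<le> (\<Sum>n\<in>F.
        3 * ((cmod (\<psi> (n + 1)))\<^sup>2 + (cmod (\<psi> (n + - 1)))\<^sup>2 + c\<^sup>2 * (cmod (\<psi> (n + 0)))\<^sup>2))"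
      by (intro sum_mono pt)
    also have "\<dots> = 3 * ((\<Sum>n\<in>F. (cmod (\<psi> (n + 1)))\<^sup>2) + (\<Sum>n\<in>F. (cmod (\<psi> (n + - 1)))\<^sup>2) +
        c\<^sup>2 * (\<Sum>n\<in>F. (cmod (\<psi> (n + 0)))\<^sup>2))"
      by (simp add: sum.distrib flip: sum_distrib_left)
    also have "\<dots> \<le> 3 * (ell2_sqnorm \<psi> + ell2_sqnorm \<psi> + c\<^sup>2 * ell2_sqnorm \<psi>)"
      by (intro mult_left_mono add_mono sum_translate_le_ell2_sqnorm \<psi> F) simp_all
    finally show ?thesis by (simp add: algebra_simps)
  qed
  note bound = this
  show "schroedinger f x \<psi> \<in> ell2" by (rule ell2_if_bounded(1)[OF bound])
  show "ell2_sqnorm (schroedinger f x \<psi>) \<le> 3 * (2 + c\<^sup>2) * ell2_sqnorm \<psi>"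
    by (rule ell2_if_bounded(2)[OF bound])
qed

text \<open>
  The summand is the difference \<open>J n - J (n - 1)\<close> of the current \<open>J n = Im (cnj (\<psi> n) * \<psi> (n + 1))\<close>,
  which is summable.
\<close>
lemma schroedinger_symmetric:
  assumes \<psi>: "\<psi> \<in> ell2"
  shows "((\<lambda>n. Im (cnj (\<psi> n) * schroedinger f x \<psi> n)) has_sum 0) UNIV"
proof -
  define J where "J = (\<lambda>n. Im (cnj (\<psi> n) * \<psi> (n + 1)))"
  have "(\<lambda>n. cnj (\<psi> n) * \<psi> (n + 1)) summable_on UNIV"
    by (intro ell2_product_summable \<psi> ell2_translate)
  then obtain S where "((\<lambda>n. cnj (\<psi> n) * \<psi> (n + 1)) has_sum S) UNIV"
    by (auto simp: summable_on_def)
  then have J: "(J has_sum Im S) UNIV"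
    unfolding J_def by (rule has_sum_Im)
  have "bij_betw (\<lambda>n::int. n - 1) UNIV UNIV"
    by (rule bij_betwI[of _ _ _ "\<lambda>n. n + 1"]) auto
  then have "((\<lambda>n. J (n - 1)) has_sum Im S) UNIV"
    using J by (subst has_sum_reindex_bij_betw[where g = "\<lambda>n::int. n - 1"]) auto
  then have "((\<lambda>n. J n + - J (n - 1)) has_sum (Im S + - Im S)) UNIV"
    by (intro has_sum_add J) (simp add: has_sum_uminus)
  moreover have "J n + - J (n - 1) = Im (cnj (\<psi> n) * schroedinger f x \<psi> n)" for n
    by (simp add: J_def schroedinger_def algebra_simps)
  ultimately show ?thesis by simp
qed

text \<open>
  The symmetric part of \<open>H - z\<close> contributes nothing to the imaginary part, only \<open>- z\<close> does. This gives
  injectivity of \<open>H - z\<close>, the bound on its inverse and the fact that spectral measures of nonzero vectors do not vanish.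
\<close>
lemma dissipation_identity:
  assumes \<psi>: "\<psi> \<in> ell2"
  shows "((\<lambda>n. Im (cnj (minus_scalar (schroedinger f x) z \<psi> n) * \<psi> n)) has_sum (Im z * ell2_sqnorm \<psi>)) UNIV"
proof -
  have "((\<lambda>n. Im z * (cmod (\<psi> n))\<^sup>2 + - Im (cnj (\<psi> n) * schroedinger f x \<psi> n)) has_sum
      (Im z * ell2_sqnorm \<psi> + - 0)) UNIV"
    by (intro has_sum_add has_sum_cmult_right ell2_has_sum[OF \<psi>]
        iffD2[OF has_sum_uminus]) (simp only: minus_minus schroedinger_symmetric[OF \<psi>])
  moreover have "Im z * (cmod (\<psi> n))\<^sup>2 + - Im (cnj (\<psi> n) * schroedinger f x \<psi> n) =
      Im (cnj (minus_scalar (schroedinger f x) z \<psi> n) * \<psi> n)" for n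
    unfolding minus_scalar_def cmod_power2 by (simp add: power2_eq_square algebra_simps)
  ultimately show ?thesis by simp
qed

text \<open>
  The dissipation identity bounds \<open>Im z\<close> times the square norm of \<open>\<psi>\<close> by a sum of products; splitting each
  product with the inequality between the arithmetic and the geometric mean replaces the
  Cauchy-Schwarz inequality.
\<close>
lemma resolvent_bound:
  assumes \<psi>: "\<psi> \<in> ell2" and \<phi>: "minus_scalar (schroedinger f x) z \<psi> \<in> ell2" and z: "Im z > 0"
  shows "(Im z)\<^sup>2 * ell2_sqnorm \<psi> \<le> ell2_sqnorm (minus_scalar (schroedinger f x) z \<psi>)"
proof -
  let ?\<phi> = "minus_scalar (schroedinger f x) z \<psi>" and ?e = "Im z"
  have "((\<lambda>n. ?e / 2 * (cmod (\<psi> n))\<^sup>2 + 1 / (2 * ?e) * (cmod (?\<phi> n))\<^sup>2) has_sum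
      (?e / 2 * ell2_sqnorm \<psi> + 1 / (2 * ?e) * ell2_sqnorm ?\<phi>)) UNIV"
    by (intro has_sum_add has_sum_cmult_right ell2_has_sum \<psi> \<phi>)
  moreover have "Im (cnj (?\<phi> n) * \<psi> n) \<le> ?e / 2 * (cmod (\<psi> n))\<^sup>2 + 1 / (2 * ?e) * (cmod (?\<phi> n))\<^sup>2" for n
  proof -
    have "Im (cnj (?\<phi> n) * \<psi> n) \<le> cmod (cnj (?\<phi> n) * \<psi> n)"
      by (rule order_trans[OF abs_ge_self abs_Im_le_cmod])
    also have "\<dots> = cmod (?\<phi> n) * cmod (\<psi> n)" by (simp add: norm_mult)
    also have "\<dots> \<le> ?e / 2 * (cmod (\<psi> n))\<^sup>2 + 1 / (2 * ?e) * (cmod (?\<phi> n))\<^sup>2"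
    proof -
      have "0 \<le> (?e * cmod (\<psi> n) - cmod (?\<phi> n))\<^sup>2 / (2 * ?e)" using z by simp
      also have "\<dots> = ?e / 2 * (cmod (\<psi> n))\<^sup>2 + 1 / (2 * ?e) * (cmod (?\<phi> n))\<^sup>2 - cmod (?\<phi> n) * cmod (\<psi> n)"
        using z by (simp add: field_simps power2_eq_square)
      finally show ?thesis by simp
    qed
    finally show ?thesis .
  qed
  ultimately have "?e * ell2_sqnorm \<psi> \<le> ?e / 2 * ell2_sqnorm \<psi> + 1 / (2 * ?e) * ell2_sqnorm ?\<phi>"
    using has_sum_mono[OF dissipation_identity[OF \<psi>]] by blast
  then show ?thesis using z by (simp add: field_simps power2_eq_square)
qed

lemma ell2_zero_iff:
  assumes "\<psi> \<in> ell2" shows "ell2_sqnorm \<psi> \<le> 0 \<longleftrightarrow> \<psi> = (\<lambda>n. 0)"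
proof
  assume *: "ell2_sqnorm \<psi> \<le> 0"
  have "(cmod (\<psi> n))\<^sup>2 \<le> 0" for n
    using norm_sq_le_ell2_sqnorm[OF assms] * by (rule order_trans)
  then have "\<psi> n = 0" for n by simp
  then show "\<psi> = (\<lambda>n. 0)" by blast
qed simp

lemma minus_scalar_linear:
  "minus_scalar (schroedinger f x) z (\<lambda>n. a * \<psi> n + b * \<eta> n) =
   (\<lambda>n. a * minus_scalar (schroedinger f x) z \<psi> n + b * minus_scalar (schroedinger f x) z \<eta> n)"
  by (simp add: minus_scalar_def schroedinger_def algebra_simps)

lemma minus_scalar_inj:
  assumes z: "Im z > 0" shows "inj_on (minus_scalar (schroedinger f x) z) ell2"
proof (rule inj_onI)
  fix \<psi> \<eta> assume *: "\<psi> \<in> ell2" "\<eta> \<in> ell2"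
    "minus_scalar (schroedinger f x) z \<psi> = minus_scalar (schroedinger f x) z \<eta>"
  define \<theta> where "\<theta> = (\<lambda>n. 1 * \<psi> n + (- 1) * \<eta> n)"
  have \<theta>: "\<theta> \<in> ell2" unfolding \<theta>_def using * by (intro ell2_linear_combination)
  have zero: "minus_scalar (schroedinger f x) z \<theta> = (\<lambda>n. 0)"
    unfolding \<theta>_def minus_scalar_linear *(3) by simp
  have "(\<lambda>n. 0) \<in> ell2" by (simp add: ell2_def)
  then have "(Im z)\<^sup>2 * ell2_sqnorm \<theta> \<le> 0"
    using resolvent_bound[OF \<theta> _ z, of f x] unfolding zero by simp
  then have "ell2_sqnorm \<theta> \<le> 0" using z by (simp add: mult_le_0_iff)
  then have "\<theta> = (\<lambda>n. 0)" using ell2_zero_iff[OF \<theta>] by blast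
  then show "\<psi> = \<eta>" by (simp add: \<theta>_def fun_eq_iff)
qed

text \<open>
  Write \<open>H - z = B - \<i> Im z\<close> with the symmetric operator \<open>B = H - Re z\<close>. Then
  \<open>1 - \<i> s (H - z) = (1 - s Im z) - \<i> s B\<close>, and by symmetry of \<open>B\<close> the cross term of the square norm
  vanishes, leaving the factor \<open>(1 - s Im z)\<^sup>2 + s\<^sup>2 K\<close>, where \<open>K\<close> bounds the square of the norm of \<open>B\<close>.
  The given \<open>s\<close> minimises it.
\<close>
lemma damped_step_contraction:
  assumes \<psi>: "\<psi> \<in> ell2" and c: "\<And>n. \<bar>f (x n)\<bar> \<le> c" and z: "Im z > 0"
  defines "K \<equiv> 3 * (2 + (c + \<bar>Re z\<bar>)\<^sup>2)"
  defines "s \<equiv> Im z / ((Im z)\<^sup>2 + K)"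
  defines "T \<equiv> \<lambda>n. \<psi> n - \<i> * complex_of_real s * minus_scalar (schroedinger f x) z \<psi> n"
  shows "T \<in> ell2" and "ell2_sqnorm T \<le> (1 - (Im z)\<^sup>2 / ((Im z)\<^sup>2 + K)) * ell2_sqnorm \<psi>"
proof -
  let ?e = "Im z"
  let ?g = "\<lambda>a. f a - Re z"
  let ?B = "schroedinger ?g x \<psi>"
  have K: "K > 0" unfolding K_def by (simp add: add_pos_nonneg)
  have c': "\<bar>?g (x n)\<bar> \<le> c + \<bar>Re z\<bar>" for n using c[of n] by linarith
  have B: "?B \<in> ell2" "ell2_sqnorm ?B \<le> K * ell2_sqnorm \<psi>"
    using schroedinger_sqnorm_bound[where f = ?g and x = x, OF \<psi> c'] by (simp_all add: K_def)
  have T: "T n = complex_of_real (1 - s * ?e) * \<psi> n - \<i> * complex_of_real s * ?B n" for n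
    unfolding T_def minus_scalar_def schroedinger_def
    by (simp add: complex_eq_iff algebra_simps)
  have pt: "(cmod (T n))\<^sup>2 = (1 - s * ?e)\<^sup>2 * (cmod (\<psi> n))\<^sup>2 + s\<^sup>2 * (cmod (?B n))\<^sup>2 +
      2 * (1 - s * ?e) * s * Im (cnj (\<psi> n) * ?B n)" for n
    unfolding T cmod_power2 by (simp add: power2_eq_square algebra_simps)
  have sum: "((\<lambda>n. (cmod (T n))\<^sup>2) has_sum
      ((1 - s * ?e)\<^sup>2 * ell2_sqnorm \<psi> + s\<^sup>2 * ell2_sqnorm ?B + 2 * (1 - s * ?e) * s * 0)) UNIV"
    unfolding pt
    by (intro has_sum_add has_sum_cmult_right ell2_has_sum \<psi> B schroedinger_symmetric)
  then show "T \<in> ell2" unfolding ell2_def summable_on_def by blast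
  have "ell2_sqnorm T = (1 - s * ?e)\<^sup>2 * ell2_sqnorm \<psi> + s\<^sup>2 * ell2_sqnorm ?B"
    using infsumI[OF sum] by simp
  also have "\<dots> \<le> (1 - s * ?e)\<^sup>2 * ell2_sqnorm \<psi> + s\<^sup>2 * (K * ell2_sqnorm \<psi>)"
    using B by (intro add_left_mono mult_left_mono) auto
  also have "\<dots> = ((1 - s * ?e)\<^sup>2 + s\<^sup>2 * K) * ell2_sqnorm \<psi>" by (simp add: algebra_simps)
  also have "(1 - s * ?e)\<^sup>2 + s\<^sup>2 * K = 1 - ?e\<^sup>2 / (?e\<^sup>2 + K)"
  proof -
    define d where "d = ?e\<^sup>2 + K"
    have d: "d > 0" using K unfolding d_def by (simp add: add_nonneg_pos)
    have s: "s = ?e / d" by (simp add: s_def d_def)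
    have "(1 - s * ?e)\<^sup>2 + s\<^sup>2 * K = 1 - 2 * (s * ?e) + s\<^sup>2 * d"
      unfolding d_def by (simp add: power2_eq_square algebra_simps)
    also have "\<dots> = 1 - ?e\<^sup>2 / d" unfolding s using d by (simp add: field_simps power2_eq_square)
    finally show ?thesis by (simp add: d_def)
  qed
  finally show "ell2_sqnorm T \<le> (1 - (Im z)\<^sup>2 / ((Im z)\<^sup>2 + K)) * ell2_sqnorm \<psi>" .
qed

lemma ell2_pointwise_limit:
  assumes lim: "\<And>n. (\<lambda>j. \<psi> j n) \<longlonglongrightarrow> \<eta> n" and "\<And>j. \<psi> j \<in> ell2" "\<And>j. ell2_sqnorm (\<psi> j) \<le> B"
  shows "\<eta> \<in> ell2"
proof (rule ell2_if_bounded(1))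
  fix F :: "int set" assume "finite F"
  have "(\<lambda>j. \<Sum>n\<in>F. (cmod (\<psi> j n))\<^sup>2) \<longlonglongrightarrow> (\<Sum>n\<in>F. (cmod (\<eta> n))\<^sup>2)"
    by (intro tendsto_sum tendsto_power tendsto_norm lim)
  moreover have "(\<Sum>n\<in>F. (cmod (\<psi> j n))\<^sup>2) \<le> B" for j
    using sum_le_ell2_sqnorm[OF assms(2) \<open>finite F\<close>] assms(3) by (rule order_trans)
  ultimately show "(\<Sum>n\<in>F. (cmod (\<eta> n))\<^sup>2) \<le> B"
    by (intro LIMSEQ_le_const2) auto
qed

text \<open>
  Solutions of \<open>(H - z) \<psi> = \<phi>\<close> are the fixed points of the contraction
  \<open>\<psi> \<mapsto> T \<psi> + \<i> s \<phi>\<close>, so the geometric series of the iterates of \<open>T\<close> applied to \<open>\<i> s \<phi>\<close>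
  is a solution. Its terms depend on neighbouring sites only, so pointwise convergence suffices for
  the equation, and the partial sums bounded in norm give square-summability.
\<close>
lemma minus_scalar_surj:
  assumes \<phi>: "\<phi> \<in> ell2" and c: "\<And>n. \<bar>f (x n)\<bar> \<le> c" and z: "Im z > 0"
  shows "\<exists>\<psi>\<in>ell2. minus_scalar (schroedinger f x) z \<psi> = \<phi>"
proof -
  let ?H = "minus_scalar (schroedinger f x) z"
  define K where "K = 3 * (2 + (c + \<bar>Re z\<bar>)\<^sup>2)"
  define s where "s = Im z / ((Im z)\<^sup>2 + K)"
  define q where "q = 1 - (Im z)\<^sup>2 / ((Im z)\<^sup>2 + K)"
  define T where "T = (\<lambda>\<psi> n. \<psi> n - \<i> * complex_of_real s * ?H \<psi> n)"
  have K: "K > 0" unfolding K_def by (simp add: add_pos_nonneg)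
  then have d: "(Im z)\<^sup>2 + K > 0" by (simp add: add_nonneg_pos)
  have s: "s \<noteq> 0" using z d by (simp add: s_def)
  have q: "0 \<le> q" "q < 1" using z d K by (simp_all add: q_def divide_le_eq)
  have T: "T \<psi> \<in> ell2" "ell2_sqnorm (T \<psi>) \<le> q * ell2_sqnorm \<psi>" if "\<psi> \<in> ell2" for \<psi>
    using damped_step_contraction[where f = f and x = x, OF that c z] unfolding T_def K_def s_def q_def by simp_all
  define D where "D = (\<lambda>j. (T ^^ j) (\<lambda>n. \<i> * complex_of_real s * \<phi> n))"
  have D0: "D 0 = (\<lambda>n. \<i> * complex_of_real s * \<phi> n)" and D_Suc: "D (Suc j) = T (D j)" for j
    by (simp_all add: D_def)
  have D0_ell2: "D 0 \<in> ell2"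
    unfolding D0 using ell2_linear_combination[OF \<phi> \<phi>, of "\<i> * complex_of_real s" 0] by simp
  define M where "M = ell2_sqnorm (D 0)"
  have D: "D j \<in> ell2 \<and> ell2_sqnorm (D j) \<le> q ^ j * M" for j
  proof (induction j)
    case 0
    then show ?case using D0_ell2 by (simp add: M_def)
  next
    case (Suc j)
    then have "ell2_sqnorm (D (Suc j)) \<le> q * (q ^ j * M)"
      unfolding D_Suc using T(2)[of "D j"] q(1) by (meson mult_left_mono order_trans)
    then show ?case using Suc T(1) by (simp add: D_Suc mult.assoc)
  qed
  define r where "r = sqrt q"
  have r: "0 \<le> r" "r < 1" using q by (simp_all add: r_def)
  have D_root: "sqrt (ell2_sqnorm (D j)) \<le> r ^ j * sqrt M" for j
    using D[of j] by (metis r_def real_sqrt_le_mono real_sqrt_mult real_sqrt_power)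
  have D_pt: "cmod (D j n) \<le> r ^ j * sqrt M" for j n
    using D_root[of j] real_sqrt_le_mono[OF norm_sq_le_ell2_sqnorm[of "D j" n]] D[of j] by simp
  have geom: "summable (\<lambda>j. r ^ j * sqrt M)"
    using r by (intro summable_mult2 summable_geometric) simp
  have D_summable: "summable (\<lambda>j. D j n)" for n
    by (rule summable_comparison_test'[OF geom, of 0]) (rule D_pt)
  define \<psi> where "\<psi> = (\<lambda>n. \<Sum>j. D j n)"
  define P where "P = (\<lambda>N n. \<Sum>j<N. D j n)"
  have lim: "(\<lambda>N. P N n) \<longlonglongrightarrow> \<psi> n" for n
    unfolding P_def \<psi>_def by (rule summable_LIMSEQ[OF D_summable])
  define B where "B = (\<Sum>j. r ^ j * sqrt M)"
  have P_bound: "(\<Sum>n\<in>F. (cmod (P N n))\<^sup>2) \<le> B\<^sup>2" if F: "finite F" for N F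
  proof -
    have L2_D: "L2_set (\<lambda>n. cmod (D j n)) F \<le> r ^ j * sqrt M" for j
    proof -
      have "L2_set (\<lambda>n. cmod (D j n)) F \<le> sqrt (ell2_sqnorm (D j))"
        unfolding L2_set_def using sum_le_ell2_sqnorm[OF _ F] D by simp
      then show ?thesis using D_root order_trans by blast
    qed
    have "L2_set (\<lambda>n. cmod (P N n)) F \<le> (\<Sum>j<N. r ^ j * sqrt M)"
    proof (induction N)
      case 0
      show ?case by (simp add: P_def L2_set_def)
    next
      case (Suc N)
      have "L2_set (\<lambda>n. cmod (P (Suc N) n)) F \<le> L2_set (\<lambda>n. cmod (P N n) + cmod (D N n)) F"
        unfolding P_def by (rule L2_set_mono) (auto intro: norm_triangle_ineq)
      also have "\<dots> \<le> L2_set (\<lambda>n. cmod (P N n)) F + L2_set (\<lambda>n. cmod (D N n)) F"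
        by (rule L2_set_triangle_ineq)
      also have "\<dots> \<le> (\<Sum>j<Suc N. r ^ j * sqrt M)" using Suc L2_D[of N] by simp
      finally show ?case .
    qed
    also have "\<dots> \<le> B"
      unfolding B_def using r by (intro sum_le_suminf geom) (auto simp: M_def ell2_sqnorm_nonneg)
    finally have "L2_set (\<lambda>n. cmod (P N n)) F \<le> B" .
    then have "(L2_set (\<lambda>n. cmod (P N n)) F)\<^sup>2 \<le> B\<^sup>2"
      by (intro power_mono) simp_all
    then show ?thesis by (simp add: L2_set_def sum_nonneg)
  qed
  have "\<psi> \<in> ell2"
    by (rule ell2_pointwise_limit[OF lim ell2_if_bounded(1)[OF P_bound] ell2_if_bounded(2)[OF P_bound]])
  moreover have "?H \<psi> = \<phi>"
  proof
    fix n
    have sums: "(\<lambda>j. D j m) sums \<psi> m" for m unfolding \<psi>_def by (rule summable_sums[OF D_summable])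
    have H: "(\<lambda>j. ?H (D j) n) sums ?H \<psi> n"
      unfolding minus_scalar_def schroedinger_def
      by (intro sums_diff sums_add sums_mult sums)
    have "(\<lambda>j. D (Suc j) n) sums (\<psi> n - D 0 n)"
      using sums[of n] by (intro iffD2[OF sums_Suc_iff]) simp
    moreover have "(\<lambda>j. D (Suc j) n) sums (\<psi> n - \<i> * complex_of_real s * ?H \<psi> n)"
      unfolding D_Suc T_def by (intro sums_diff sums_mult sums H)
    ultimately have "\<psi> n - D 0 n = \<psi> n - \<i> * complex_of_real s * ?H \<psi> n"
      by (rule sums_unique2)
    then show "?H \<psi> n = \<phi> n" using s by (simp add: D0)
  qed
  ultimately show ?thesis by blast
qed

lemma resolvent_solves:
  assumes \<phi>: "\<phi> \<in> ell2" and c: "\<And>n. \<bar>f (x n)\<bar> \<le> c" and z: "Im z > 0"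
  shows "resolvent_on ell2 (schroedinger f x) z \<phi> \<in> ell2"
    and "minus_scalar (schroedinger f x) z (resolvent_on ell2 (schroedinger f x) z \<phi>) = \<phi>"
proof -
  obtain \<psi> where \<psi>: "\<psi> \<in> ell2" "minus_scalar (schroedinger f x) z \<psi> = \<phi>"
    using minus_scalar_surj[where f = f and x = x, OF \<phi> c z] by blast
  then have "resolvent_on ell2 (schroedinger f x) z \<phi> = \<psi>"
    unfolding resolvent_on_def using the_inv_into_f_f[OF minus_scalar_inj[OF z]] by blast
  then show "resolvent_on ell2 (schroedinger f x) z \<phi> \<in> ell2"
    and "minus_scalar (schroedinger f x) z (resolvent_on ell2 (schroedinger f x) z \<phi>) = \<phi>"
    using \<psi> by simp_all
qed

section \<open>Atoms of spectral measures\<close>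

text \<open>
  A finite set carries almost all of \<open>\<phi>\<close>. On it the products tend to zero; off it they are bounded by
  \<open>t * \<bar>\<phi> n\<bar>\<^sup>2 + \<bar>\<psi> j n\<bar>\<^sup>2 / t\<close>, where first \<open>t\<close> is taken large and then the finite set.
\<close>
lemma ell2_inner_weak_null:
  assumes \<phi>: "\<phi> \<in> ell2" and \<psi>: "\<And>j. \<psi> j \<in> ell2" "\<And>j. ell2_sqnorm (\<psi> j) \<le> B"
    and lim: "\<And>n. (\<lambda>j. \<psi> j n) \<longlonglongrightarrow> 0"
  shows "(\<lambda>j. ell2_inner \<phi> (\<psi> j)) \<longlonglongrightarrow> 0"
proof (rule LIMSEQ_I)
  fix e :: real assume e: "e > 0"
  have B: "B \<ge> 0" using \<psi>(2)[of 0] ell2_sqnorm_nonneg[of "\<psi> 0"] by linarith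
  define t where "t = 4 * (B + 1) / e"
  have t: "t > 0" using e B by (simp add: t_def)
  have Bt: "B / t \<le> e / 4"
    using e B by (simp add: t_def field_simps)
  obtain F where F: "finite F" "ell2_sqnorm \<phi> - e / (4 * t) < (\<Sum>n\<in>F. (cmod (\<phi> n))\<^sup>2)"
  proof -
    have "(sum (\<lambda>n. (cmod (\<phi> n))\<^sup>2) \<longlongrightarrow> ell2_sqnorm \<phi>) (finite_subsets_at_top UNIV)"
      using ell2_has_sum[OF \<phi>] by (simp add: has_sum_def)
    moreover have "ell2_sqnorm \<phi> - e / (4 * t) < ell2_sqnorm \<phi>" using e t by simp
    ultimately have "\<forall>\<^sub>F F in finite_subsets_at_top UNIV.
        ell2_sqnorm \<phi> - e / (4 * t) < (\<Sum>n\<in>F. (cmod (\<phi> n))\<^sup>2)"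
      by (rule order_tendstoD(1))
    then show thesis using that by (auto simp: eventually_finite_subsets_at_top)
  qed
  have "(\<lambda>j. \<Sum>n\<in>F. cmod (cnj (\<phi> n) * \<psi> j n)) \<longlonglongrightarrow> (\<Sum>n\<in>F. cmod (cnj (\<phi> n) * 0))"
    by (intro tendsto_sum tendsto_norm tendsto_mult tendsto_const lim)
  then have "(\<lambda>j. \<Sum>n\<in>F. cmod (cnj (\<phi> n) * \<psi> j n)) \<longlonglongrightarrow> 0" by simp
  then obtain N where N: "\<And>j. j \<ge> N \<Longrightarrow> \<bar>\<Sum>n\<in>F. cmod (cnj (\<phi> n) * \<psi> j n)\<bar> < e / 4"
    using LIMSEQ_D[of _ 0 "e / 4"] e by fastforce
  have "norm (ell2_inner \<phi> (\<psi> j) - 0) < e" if "j \<ge> N" for j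
  proof -
    let ?g = "\<lambda>n. cmod (cnj (\<phi> n) * \<psi> j n)"
    have "sum ?g G \<le> 3 * e / 4" if G: "finite G" for G
    proof -
      have tail: "?g n \<le> t * (cmod (\<phi> n))\<^sup>2 + (cmod (\<psi> j n))\<^sup>2 / t" for n
      proof -
        have "0 \<le> (t * cmod (\<phi> n) - cmod (\<psi> j n))\<^sup>2 / t" using t by simp
        also have "\<dots> = t * (cmod (\<phi> n))\<^sup>2 + (cmod (\<psi> j n))\<^sup>2 / t - 2 * (cmod (\<phi> n) * cmod (\<psi> j n))"
          using t by (simp add: field_simps power2_eq_square)
        finally have "2 * (cmod (\<phi> n) * cmod (\<psi> j n)) \<le> t * (cmod (\<phi> n))\<^sup>2 + (cmod (\<psi> j n))\<^sup>2 / t"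
          by simp
        then show ?thesis
          using mult_nonneg_nonneg[OF norm_ge_zero[of "\<phi> n"] norm_ge_zero[of "\<psi> j n"]]
          unfolding norm_mult complex_mod_cnj by linarith
      qed
      have "sum ?g G \<le> sum ?g (F \<union> (G - F))"
        using F(1) G by (intro sum_mono2) auto
      also have "\<dots> = sum ?g F + sum ?g (G - F)"
        using F(1) G by (intro sum.union_disjoint) auto
      also have "sum ?g F \<le> e / 4" using N[OF \<open>j \<ge> N\<close>] by linarith
      also have "sum ?g (G - F) \<le> (\<Sum>n\<in>G - F. t * (cmod (\<phi> n))\<^sup>2 + (cmod (\<psi> j n))\<^sup>2 / t)"
        by (intro sum_mono tail)
      also have "\<dots> = t * (\<Sum>n\<in>G - F. (cmod (\<phi> n))\<^sup>2) + (\<Sum>n\<in>G - F. (cmod (\<psi> j n))\<^sup>2) / t"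
        by (simp add: sum.distrib sum_distrib_left sum_divide_distrib)
      also have "(\<Sum>n\<in>G - F. (cmod (\<phi> n))\<^sup>2) \<le> e / (4 * t)"
      proof -
        have "(\<Sum>n\<in>F. (cmod (\<phi> n))\<^sup>2) + (\<Sum>n\<in>G - F. (cmod (\<phi> n))\<^sup>2) = (\<Sum>n\<in>F \<union> (G - F). (cmod (\<phi> n))\<^sup>2)"
          using F(1) G by (intro sum.union_disjoint[symmetric]) auto
        also have "\<dots> \<le> ell2_sqnorm \<phi>"
          using F(1) G by (intro sum_le_ell2_sqnorm \<phi>) auto
        finally show ?thesis using F(2) by linarith
      qed
      also have "(\<Sum>n\<in>G - F. (cmod (\<psi> j n))\<^sup>2) \<le> B"
        using sum_le_ell2_sqnorm[OF \<psi>(1), of "G - F" j] \<psi>(2)[of j] G by auto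
      finally have "sum ?g G \<le> e / 4 + (t * (e / (4 * t)) + B / t)"
        using t by (simp add: divide_right_mono)
      moreover have "t * (e / (4 * t)) = e / 4" using t by simp
      ultimately show ?thesis using Bt by linarith
    qed
    then have "infsum ?g UNIV \<le> 3 * e / 4"
      by (intro infsum_le_finite_sums ell2_product_summable \<phi> \<psi>) auto
    moreover have "norm (ell2_inner \<phi> (\<psi> j)) \<le> infsum ?g UNIV"
      unfolding ell2_inner_def
      by (intro norm_infsum_bound ell2_product_summable \<phi> \<psi>)
    ultimately show ?thesis using e by simp
  qed
  then show "\<exists>N. \<forall>j\<ge>N. norm (ell2_inner \<phi> (\<psi> j) - 0) < e" by blast
qed

text \<open>
  The functions \<open>\<epsilon> / (t - E - \<i> \<epsilon>)\<close> have modulus at most one, equal \<open>\<i>\<close> at \<open>t = E\<close>, and tend to zero elsewhere.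
\<close>
lemma stieltjes_atom_limit:
  assumes sets: "sets \<mu> = sets borel" and fin: "finite_measure \<mu>"
  shows "(\<lambda>j. complex_of_real (1 / real (Suc j)) *
      (LINT t|\<mu>. 1 / (complex_of_real t - Complex E (1 / real (Suc j)))))
    \<longlonglongrightarrow> \<i> * complex_of_real (measure \<mu> {E})"
proof -
  interpret finite_measure \<mu> by fact
  define e where "e = (\<lambda>j. 1 / real (Suc j))"
  have e: "e j > 0" for j by (simp add: e_def)
  have e_lim: "e \<longlonglongrightarrow> 0" unfolding e_def by (rule LIMSEQ_inverse_real_of_nat[unfolded inverse_eq_divide])
  define s where "s = (\<lambda>j t. complex_of_real (e j) * (1 / (complex_of_real t - Complex E (e j))))"
  define g where "g = (\<lambda>t. \<i> * complex_of_real (indicat_real {E} t))"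
  have s_meas: "s j \<in> borel_measurable \<mu>" for j
    unfolding s_def measurable_cong_sets[OF sets refl] by measurable
  have g_meas: "g \<in> borel_measurable \<mu>"
    unfolding g_def measurable_cong_sets[OF sets refl] by measurable
  have bound: "norm (s j t) \<le> 1" for j t
  proof -
    have "e j \<le> cmod (complex_of_real t - Complex E (e j))"
      using abs_Im_le_cmod[of "complex_of_real t - Complex E (e j)"] e[of j] by simp
    then show ?thesis using e[of j] by (simp add: s_def norm_mult norm_divide divide_le_eq)
  qed
  have lim: "(\<lambda>j. s j t) \<longlonglongrightarrow> g t" for t
  proof (cases "t = E")
    case True
    have "s j t = \<i>" for j
    proof -
      have "complex_of_real t - Complex E (e j) = - (\<i> * complex_of_real (e j))"
        by (simp add: True complex_eq_iff)
      then have "s j t = complex_of_real (e j) * (1 / - (\<i> * complex_of_real (e j)))"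
        by (simp only: s_def)
      then show ?thesis using e[of j] by (simp add: field_simps)
    qed
    then show ?thesis by (simp add: g_def True)
  next
    case False
    have 1: "(\<lambda>j. complex_of_real (e j)) \<longlonglongrightarrow> complex_of_real 0"
      by (intro tendsto_of_real e_lim)
    have C: "Complex E (e j) = complex_of_real E + \<i> * complex_of_real (e j)" for j
      by (simp add: complex_eq_iff)
    have "(\<lambda>j. complex_of_real (e j) * (1 / (complex_of_real t - (complex_of_real E + \<i> * complex_of_real (e j)))))
      \<longlonglongrightarrow> complex_of_real 0 * (1 / (complex_of_real t - (complex_of_real E + \<i> * complex_of_real 0)))"
      using False by (intro tendsto_intros 1) auto
    then show ?thesis using False by (simp add: s_def g_def C)
  qed
  have "(\<lambda>j. integral\<^sup>L \<mu> (s j)) \<longlonglongrightarrow> integral\<^sup>L \<mu> g"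
    by (rule integral_dominated_convergence[where w = "\<lambda>_. 1"])
      (use s_meas g_meas bound lim in auto)
  moreover have "integral\<^sup>L \<mu> g = \<i> * complex_of_real (measure \<mu> {E})"
    unfolding g_def by (simp add: sets)
  moreover have "integral\<^sup>L \<mu> (s j) =
      complex_of_real (e j) * (LINT t|\<mu>. 1 / (complex_of_real t - Complex E (e j)))" for j
    unfolding s_def by (rule integral_mult_right_zero)
  ultimately show ?thesis by (simp add: e_def)
qed

text \<open>
  The rescaled resolvent vectors \<open>u\<close> satisfy \<open>(H - E - \<i> \<epsilon>) u = \<epsilon> \<phi>\<close>. By this recursion their values at
  \<open>0\<close> and \<open>-1\<close> determine all others, so a subsequence along which these two numbers converge converges at
  every site, to a solution of the eigenvalue equation. It is nonzero because the inner products with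
  \<open>\<phi>\<close> tend to \<open>\<i>\<close> times the mass of the atom.
\<close>
lemma eigenvector_of_atom:
  assumes \<phi>: "\<phi> \<in> ell2" and c: "\<And>n. \<bar>f (x n)\<bar> \<le> c"
    and spec: "is_spectral_measure (schroedinger f x) \<phi> \<mu>" and atom: "measure \<mu> {E} \<noteq> 0"
  shows "\<exists>\<psi>\<in>ell2. \<psi> \<noteq> (\<lambda>n. 0) \<and> schroedinger f x \<psi> = (\<lambda>n. complex_of_real E * \<psi> n)"
proof -
  let ?H = "schroedinger f x"
  define e where "e = (\<lambda>j. 1 / real (Suc j))"
  have e: "e j > 0" for j by (simp add: e_def)
  have e_lim: "(\<lambda>j. complex_of_real (e j)) \<longlonglongrightarrow> complex_of_real 0"
    unfolding e_def by (intro tendsto_of_real LIMSEQ_inverse_real_of_nat[unfolded inverse_eq_divide])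
  define z where "z = (\<lambda>j. Complex E (e j))"
  have z: "Im (z j) > 0" for j using e by (simp add: z_def)
  have z_eq: "z j = complex_of_real E + \<i> * complex_of_real (e j)" for j
    by (simp add: z_def complex_eq_iff)
  have "(\<lambda>j. complex_of_real E + \<i> * complex_of_real (e j)) \<longlonglongrightarrow> complex_of_real E + \<i> * complex_of_real 0"
    by (intro tendsto_intros e_lim)
  then have z_lim: "z \<longlonglongrightarrow> complex_of_real E" by (simp add: z_eq[abs_def])
  define \<rho> where "\<rho> = (\<lambda>j. resolvent_on ell2 ?H (z j) \<phi>)"
  have \<rho>: "\<rho> j \<in> ell2" "minus_scalar ?H (z j) (\<rho> j) = \<phi>" for j
    unfolding \<rho>_def by (rule resolvent_solves[where f = f and x = x, OF \<phi> c z])+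
  define u where "u = (\<lambda>j n. complex_of_real (e j) * \<rho> j n)"
  have u_ell2: "u j \<in> ell2" for j
    using ell2_linear_combination[OF \<rho>(1) \<rho>(1), of "complex_of_real (e j)" j 0 j] by (simp add: u_def)
  have u_norm: "ell2_sqnorm (u j) \<le> ell2_sqnorm \<phi>" for j
  proof -
    have "ell2_sqnorm (u j) = (e j)\<^sup>2 * ell2_sqnorm (\<rho> j)"
      by (simp add: u_def norm_mult power_mult_distrib infsum_cmult_right')
    also have "\<dots> \<le> ell2_sqnorm \<phi>"
      using resolvent_bound[OF \<rho>(1)[of j] _ z[of j], of f x] \<phi> unfolding \<rho>(2) by (simp add: z_def)
    finally show ?thesis .
  qed
  have u_rec: "u j (n + 1) + u j (n - 1) + complex_of_real (f (x n)) * u j n - z j * u j n =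
      complex_of_real (e j) * \<phi> n" for j n
    using arg_cong[OF fun_cong[OF \<rho>(2)[of j], of n], of "\<lambda>a. complex_of_real (e j) * a"]
    by (simp add: u_def minus_scalar_def schroedinger_def algebra_simps)
  have u_bound: "cmod (u j n) \<le> sqrt (ell2_sqnorm \<phi>)" for j n
    using order_trans[OF norm_sq_le_ell2_sqnorm[OF u_ell2] u_norm] by (rule real_le_rsqrt)
  have "bounded (range (\<lambda>j. (u j 0, u j (-1))))"
  proof -
    have "bounded (cball 0 (sqrt (ell2_sqnorm \<phi>)) \<times> cball 0 (sqrt (ell2_sqnorm \<phi>)) :: (complex \<times> complex) set)"
      by (intro bounded_Times bounded_cball)
    then show ?thesis by (rule bounded_subset) (use u_bound in auto)
  qed
  then obtain l r where r: "strict_mono (r :: nat \<Rightarrow> nat)"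
    and l: "((\<lambda>j. (u j 0, u j (-1))) \<circ> r) \<longlonglongrightarrow> l"
    using bounded_imp_convergent_subsequence by blast
  have start: "convergent (\<lambda>j. u (r j) 0)" "convergent (\<lambda>j. u (r j) (-1))"
    using tendsto_fst[OF l] tendsto_snd[OF l] by (auto simp: convergent_def o_def)
  have er: "(\<lambda>j. complex_of_real (e (r j))) \<longlonglongrightarrow> complex_of_real 0"
    using LIMSEQ_subseq_LIMSEQ[OF e_lim r] by (simp add: o_def)
  have zr: "(\<lambda>j. z (r j)) \<longlonglongrightarrow> complex_of_real E"
    using LIMSEQ_subseq_LIMSEQ[OF z_lim r] by (simp add: o_def)
  have conv_rec: "convergent (\<lambda>j. complex_of_real (e (r j)) * \<phi> n - v j -
      complex_of_real (f (x n)) * w j + z (r j) * w j)" if "convergent v" "convergent w" for v w n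
  proof -
    from that obtain v' w' where "v \<longlonglongrightarrow> v'" "w \<longlonglongrightarrow> w'" by (auto simp: convergent_def)
    then have "(\<lambda>j. complex_of_real (e (r j)) * \<phi> n - v j - complex_of_real (f (x n)) * w j + z (r j) * w j)
      \<longlonglongrightarrow> complex_of_real 0 * \<phi> n - v' - complex_of_real (f (x n)) * w' + complex_of_real E * w'"
      by (intro tendsto_intros er zr)
    then show ?thesis by (auto simp: convergent_def)
  qed
  have fwd: "u j (n + 1) = complex_of_real (e j) * \<phi> n - u j (n - 1) - complex_of_real (f (x n)) * u j n + z j * u j n"
    and bwd: "u j (n - 1) = complex_of_real (e j) * \<phi> n - u j (n + 1) - complex_of_real (f (x n)) * u j n + z j * u j n"
    for j n using u_rec[of j n] by (simp_all add: algebra_simps)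
  have up: "convergent (\<lambda>j. u (r j) (int m)) \<and> convergent (\<lambda>j. u (r j) (int m - 1))" for m
  proof (induction m)
    case (Suc m)
    then have "convergent (\<lambda>j. u (r j) (int m + 1))" unfolding fwd by (intro conv_rec) auto
    then show ?case using Suc by (simp add: add.commute)
  qed (use start in simp)
  have down: "convergent (\<lambda>j. u (r j) (- int m)) \<and> convergent (\<lambda>j. u (r j) (- int m - 1))" for m
  proof (induction m)
    case (Suc m)
    then have "convergent (\<lambda>j. u (r j) (- int m - 1 - 1))" 
      unfolding bwd[of _ "- int m - 1"] by (intro conv_rec) auto
    moreover have "- int (Suc m) = - int m - 1" by simp
    ultimately show ?case using Suc by (simp only:)
  qed (use start in simp)
  have conv: "convergent (\<lambda>j. u (r j) n)" for n
  proof (cases "n \<ge> 0")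
    case True
    then show ?thesis using up[of "nat n"] by simp
  next
    case False
    then show ?thesis using down[of "nat (- n)"] by simp
  qed
  define \<psi> where "\<psi> = (\<lambda>n. lim (\<lambda>j. u (r j) n))"
  have lim: "(\<lambda>j. u (r j) n) \<longlonglongrightarrow> \<psi> n" for n
    unfolding \<psi>_def using conv by (simp add: convergent_LIMSEQ_iff)
  have "\<psi> \<in> ell2" by (rule ell2_pointwise_limit[OF lim u_ell2 u_norm])
  moreover have "?H \<psi> = (\<lambda>n. complex_of_real E * \<psi> n)"
  proof
    fix n
    have "(\<lambda>j. u (r j) (n + 1) + u (r j) (n - 1) + complex_of_real (f (x n)) * u (r j) n - z (r j) * u (r j) n)
      \<longlonglongrightarrow> \<psi> (n + 1) + \<psi> (n - 1) + complex_of_real (f (x n)) * \<psi> n - complex_of_real E * \<psi> n"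
      by (intro tendsto_intros lim zr)
    moreover have "(\<lambda>j. complex_of_real (e (r j)) * \<phi> n) \<longlonglongrightarrow> complex_of_real 0 * \<phi> n"
      by (intro tendsto_intros er)
    ultimately have "\<psi> (n + 1) + \<psi> (n - 1) + complex_of_real (f (x n)) * \<psi> n - complex_of_real E * \<psi> n = 0"
      unfolding u_rec using LIMSEQ_unique by fastforce
    then show "?H \<psi> n = complex_of_real E * \<psi> n" by (simp add: schroedinger_def)
  qed
  moreover have "\<psi> \<noteq> (\<lambda>n. 0)"
  proof
    assume zero: "\<psi> = (\<lambda>n. 0)"
    have "(\<lambda>j. ell2_inner \<phi> (u (r j))) \<longlonglongrightarrow> 0"
      using ell2_inner_weak_null[OF \<phi> u_ell2 u_norm, of r] lim unfolding zero by blast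
    moreover have "(\<lambda>j. ell2_inner \<phi> (u j)) \<longlonglongrightarrow> \<i> * complex_of_real (measure \<mu> {E})"
    proof -
      have "ell2_inner \<phi> (u j) = complex_of_real (e j) * (LINT t|\<mu>. 1 / (complex_of_real t - z j))" for j
      proof -
        have "ell2_inner \<phi> (u j) = complex_of_real (e j) * ell2_inner \<phi> (\<rho> j)"
          unfolding ell2_inner_def u_def
          by (subst infsum_cmult_right'[symmetric]) (simp add: algebra_simps)
        then show ?thesis using spec z[of j] by (simp add: is_spectral_measure_def \<rho>_def)
      qed
      then show ?thesis
        using stieltjes_atom_limit[of \<mu> E] spec by (simp add: is_spectral_measure_def e_def z_def)
    qed
    from LIMSEQ_subseq_LIMSEQ[OF this r]
    have "(\<lambda>j. ell2_inner \<phi> (u (r j))) \<longlonglongrightarrow> \<i> * complex_of_real (measure \<mu> {E})" by (simp add: o_def)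
    ultimately have "\<i> * complex_of_real (measure \<mu> {E}) = 0" by (rule LIMSEQ_unique[rotated])
    then show False using atom by simp
  qed
  ultimately show ?thesis by blast
qed

text \<open>
  If the measure vanishes, so does the inner product of \<open>\<phi>\<close> with \<open>(H - \<i>)\<^sup>-\<^sup>1 \<phi>\<close>, whose imaginary part is
  the square norm of \<open>(H - \<i>)\<^sup>-\<^sup>1 \<phi>\<close> by the dissipation identity.
\<close>
lemma spectral_measure_nonzero:
  assumes \<phi>: "\<phi> \<in> ell2" "\<phi> \<noteq> (\<lambda>n. 0)" and c: "\<And>n. \<bar>f (x n)\<bar> \<le> c"
    and spec: "is_spectral_measure (schroedinger f x) \<phi> \<mu>"
  shows "emeasure \<mu> UNIV \<noteq> 0"
proof
  assume zero: "emeasure \<mu> UNIV = 0"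
  let ?\<psi> = "resolvent_on ell2 (schroedinger f x) \<i> \<phi>"
  have sets: "sets \<mu> = sets borel" using spec by (simp add: is_spectral_measure_def)
  have "space \<mu> = UNIV" using sets_eq_imp_space_eq[OF sets] by simp
  then have "space \<mu> \<in> null_sets \<mu>" using zero by (auto simp: null_sets_def sets)
  then have "AE t in \<mu>. 1 / (complex_of_real t - \<i>) = 0"
    by (rule AE_I') auto
  then have "(LINT t|\<mu>. 1 / (complex_of_real t - \<i>)) = 0"
    by (rule integral_eq_zero_AE)
  then have inner: "ell2_inner \<phi> ?\<psi> = 0" using spec by (simp add: is_spectral_measure_def)
  have \<psi>: "?\<psi> \<in> ell2" "minus_scalar (schroedinger f x) \<i> ?\<psi> = \<phi>"
    by (rule resolvent_solves[where f = f and x = x, OF \<phi>(1) c]; simp)+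
  have "((\<lambda>n. cnj (\<phi> n) * ?\<psi> n) has_sum 0) UNIV"
    using ell2_product_summable(1)[OF \<phi>(1) \<psi>(1)] inner unfolding ell2_inner_def
    by (metis has_sum_infsum)
  from has_sum_Im[OF this] have "((\<lambda>n. Im (cnj (\<phi> n) * ?\<psi> n)) has_sum 0) UNIV" by simp
  moreover have "((\<lambda>n. Im (cnj (\<phi> n) * ?\<psi> n)) has_sum (Im \<i> * ell2_sqnorm ?\<psi>)) UNIV"
    using dissipation_identity[OF \<psi>(1), of f x \<i>] unfolding \<psi>(2) .
  ultimately have "Im \<i> * ell2_sqnorm ?\<psi> = 0" by (rule has_sum_unique[rotated])
  then have "?\<psi> = (\<lambda>n. 0)" using ell2_zero_iff[OF \<psi>(1)] by simp
  then have "\<phi> = (\<lambda>n. 0)" using \<psi>(2) by (simp add: minus_scalar_def schroedinger_def)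
  then show False using \<phi>(2) by simp
qed

lemma pure_point_atom:
  assumes sets: "sets \<mu> = sets borel" and fin: "finite_measure \<mu>"
    and "pure_point \<mu>" and nz: "emeasure \<mu> UNIV \<noteq> 0"
  shows "\<exists>E. measure \<mu> {E} \<noteq> 0"
proof (rule ccontr)
  assume "\<not> ?thesis"
  then have null: "{E} \<in> null_sets \<mu>" for E
    using fin by (simp add: null_sets_def sets finite_measure.emeasure_eq_measure)
  obtain C where C: "countable C" "emeasure \<mu> (UNIV - C) = 0"
    using assms(3) by (auto simp: pure_point_def)
  have "C \<in> sets borel" using C(1) by (rule sets.countable[rotated]) auto
  then have "UNIV - C \<in> null_sets \<mu>"
    using C(2) by (auto simp: null_sets_def sets)
  moreover have "(\<Union>E\<in>C. {E}) \<in> null_sets \<mu>"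
    using C(1) null by (rule null_sets_UN')
  ultimately have "(UNIV - C) \<union> (\<Union>E\<in>C. {E}) \<in> null_sets \<mu>" by (rule null_sets.Un)
  moreover have "(UNIV - C) \<union> (\<Union>E\<in>C. {E}) = UNIV" by auto
  ultimately show False using nz by auto
qed

text \<open>
  Without eigenvectors the pure point subspace is the zero space, on which every operator
  \<open>H - z\<close> is a bijection with bounded inverse.
\<close>
lemma pp_spectrum_empty:
  assumes c: "\<And>n. \<bar>f (x n)\<bar> \<le> c"
    and no_eigenvector: "\<And>\<psi> E n. \<psi> \<in> ell2 \<Longrightarrow> (\<And>m. schroedinger f x \<psi> m = complex_of_real E * \<psi> m) \<Longrightarrow> \<psi> n = 0"
  shows "pp_spectrum (schroedinger f x) = {}"
proof -
  let ?H = "schroedinger f x" and ?z = "\<lambda>n::int. 0::complex"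
  have "\<phi> = ?z" if "\<phi> \<in> pp_subspace ?H" for \<phi>
  proof (rule ccontr)
    assume nz: "\<phi> \<noteq> ?z"
    obtain \<mu> where \<phi>: "\<phi> \<in> ell2" and \<mu>: "is_spectral_measure ?H \<phi> \<mu>" "pure_point \<mu>"
      using \<open>\<phi> \<in> pp_subspace ?H\<close> by (auto simp: pp_subspace_def)
    have "emeasure \<mu> UNIV \<noteq> 0"
      by (rule spectral_measure_nonzero[where f = f and x = x, OF \<phi> nz c \<mu>(1)])
    then obtain E where E: "measure \<mu> {E} \<noteq> 0"
      using pure_point_atom[of \<mu>] \<mu> unfolding is_spectral_measure_def by blast
    obtain \<psi> where \<psi>: "\<psi> \<in> ell2" "\<psi> \<noteq> ?z" "?H \<psi> = (\<lambda>n. complex_of_real E * \<psi> n)"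
      using eigenvector_of_atom[where f = f and x = x, OF \<phi> c \<mu>(1) E] by blast
    have "\<psi> n = 0" for n by (rule no_eigenvector[OF \<psi>(1)]) (simp only: \<psi>(3))
    then show False using \<psi>(2) by blast
  qed
  moreover have "?z \<in> pp_subspace ?H"
  proof -
    have "is_spectral_measure ?H ?z (null_measure borel)"
      unfolding is_spectral_measure_def ell2_inner_def
      by (auto intro: finite_measureI simp: integral_null_measure)
    moreover have "pure_point (null_measure borel)"
      unfolding pure_point_def by (rule exI[of _ "{}"]) simp
    moreover have "?z \<in> ell2" by (simp add: ell2_def)
    ultimately show ?thesis unfolding pp_subspace_def by blast
  qed
  ultimately have pp: "pp_subspace ?H = {?z}" by blast
  have "bij_betw (minus_scalar ?H z) {?z} {?z} \<and>
      (\<exists>C. \<forall>\<phi>\<in>{?z}. ell2_norm (resolvent_on {?z} ?H z \<phi>) \<le> C * ell2_norm \<phi>)" for z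
  proof
    have 0: "minus_scalar ?H z ?z = ?z" by (simp add: minus_scalar_def schroedinger_def)
    then show "bij_betw (minus_scalar ?H z) {?z} {?z}" by (simp add: bij_betw_def)
    have "resolvent_on {?z} ?H z ?z = ?z"
      unfolding resolvent_on_def using the_inv_into_f_f[of "minus_scalar ?H z" "{?z}" ?z] 0 by simp
    then show "\<exists>C. \<forall>\<phi>\<in>{?z}. ell2_norm (resolvent_on {?z} ?H z \<phi>) \<le> C * ell2_norm \<phi>"
      by (intro exI[of _ 1]) simp
  qed
  then show ?thesis unfolding pp_spectrum_def spectrum_on_def pp by blast
qed

section \<open>Empty pure point spectrum\<close>

text \<open>
  The three-block inequality holds at every energy, so the exceptional null set depends only on the
  repetitions in \<open>x\<close> and serves all energies at once.
\<close>

theorem corollary6p6: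
  fixes k :: nat
    and X :: "(int \<Rightarrow> nat) set"
    and i :: "nat \<Rightarrow> nat"
    and \<nu> :: "(int \<Rightarrow> nat) measure"
    and f :: "nat \<Rightarrow> real"
  assumes "k \<ge> 2"
    and "AR_subshift k X"
    and "index_sequence k X i"
    and "unique_invariant_prob X \<nu>"
    and "\<not> f constant_on alphabet k"
    and "infinite (two_runs k i)"
  shows "AE x in \<nu>. pp_spectrum (schroedinger f x) = {}"
proof -
  have "prob_space \<nu>" and sets: "sets \<nu> = sets (restrict_space borel X)"
    using assms(4) by (simp_all add: unique_invariant_prob_def invariant_prob_def)
  have space: "space \<nu> = X"
    using sets_eq_imp_space_eq[OF sets] by (simp add: space_restrict_space)
  then have ne: "X \<noteq> {}"
    using prob_space.not_empty[OF \<open>prob_space \<nu>\<close>] by simp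
  have "\<exists>L. arnoux_rauzy_language k X L"
    using assms(2) unfolding AR_subshift_def
  proof (elim disjE exE conjE)
    fix x :: "nat \<Rightarrow> nat"
    assume "AR_sequence k x" "X = associated_subshift k x"
    from arnoux_rauzy_language_of_sequence[OF assms(1) this ne] show ?thesis by blast
  next
    fix x :: "int \<Rightarrow> nat"
    assume "AR_sequence k x" "X = associated_subshift k x"
    from arnoux_rauzy_language_of_sequence[OF assms(1) this ne] show ?thesis by blast
  qed
  then obtain L where "arnoux_rauzy_language k X L" by blast
  then interpret arnoux_rauzy_language k X L .
  have "pp_spectrum (schroedinger f x) = {}"
    if x: "x \<in> X" and blocks: "\<exists>m. \<forall>P. \<exists>p\<ge>P. three_blocks x m p" for x
  proof (rule pp_spectrum_empty)
    show "\<bar>f (x n)\<bar> \<le> (\<Sum>a\<in>{1..k}. \<bar>f a\<bar>)" for n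
      using letter_in_alphabet[OF x, of n] by (intro member_le_sum) auto
    obtain m where m: "\<And>P. \<exists>p\<ge>P. three_blocks x m p" using blocks by blast
    show "\<psi> n = 0"
      if "\<psi> \<in> ell2" "\<And>m. schroedinger f x \<psi> m = complex_of_real E * \<psi> m" for \<psi> E n
      using no_eigenvector[OF that m] .
  qed
  then show ?thesis
    using AE_three_blocks[OF assms(4)] AE_space[of \<nu>] unfolding space
    by (auto elim: AE_mp)
qed

end
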